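(* For any discrete memoryless channel $Q$ (in the asynchronous communication model described in the context), the synchronization threshold satisfies $$\alpha(Q)=\max_{x\in\mathcal X} D\big(Q(\cdot|x)\,\|\,Q(\cdot|\star)\big).$$ Furthermore, any asynchronism exponent $\alpha<\alpha(Q)$ can be achieved by a coding strategy (a sequence of codes, each with a sequential decoder, indexed by the blocklength $N$, with $M=M_N$ messages) that satisfies $\lim_{N\to\infty}\frac{\ln M}{N}>0$.
   Context: Model. A discrete memoryless channel has finite input alphabet $\mathcal X$, finite output alphabet $\mathcal Y$, transition probabilities $Q(y|x)$, and a distinguished "noise" input symbol $\star\in\mathcal X$. Standing assumptions: for every $y\in\mathcal Y$ there is $x\in\mathcal X$ with $Q(y|x)>0$, and the capacity $C(Q)$ of the (ordinary, synchronized) channel is strictly positive. A code consists of $M\ge 2$ equally likely messages, codewords $c^N(m)=(c_1(m),\dots,c_N(m))\in\mathcal X^N$, and a sequential decoder. The asynchronism level is an integer $A\ge 1$: the transmission start time $\nu$ is uniformly distributed on $\{1,\dots,A\}$, independent of the message. Given message $m$ and $\nu$, the outputs $Y_1,Y_2,\dots$ are independent with $Y_i\sim Q(\cdot|\star)$ if $i\le\nu-1$ or $i\ge\nu+N$, and $Y_i\sim Q(\cdot|c_{i-\nu+1}(m))$ if $\nu\le i\le \nu+N-1$. The receiver knows $A$ and the code but not $\nu$. A decoder is a pair $(\tau,\phi)$ where $\tau$ is a stopping time with respect to $Y_1,Y_2,\dots$ and $\phi$ is a function of $Y_1,\dots,Y_\tau$ returning a message. Let $\mathbb P_{m,l},\mathbb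 E_{m,l}$ denote probability and expectation given that message $m$ is sent starting at time $\nu=l$. Error probability: $\mathbb P(\mathcal E)=\frac1{AM}\sum_{m=1}^M\sum_{l=1}^A\mathbb P_{m,l}(\phi\ne m)$. Average delay: $\mathbb E(\tau-\nu)^+=\frac1{AM}\sum_{m=1}^M\sum_{l=1}^A\mathbb E_{m,l}(\tau-l)^+$, with $x^+=\max\{0,x\}$. Rate: $R=\ln M/\mathbb E(\tau-\nu)^+$ (natural logarithms). An asynchronism exponent $\alpha$ is achievable at rate $R$ if for every $\varepsilon>0$ there is a code with (sufficiently large) blocklength $N$ operating at asynchronism level $A=e^{(\alpha-\varepsilon)N}$ with rate at least $R-\varepsilon$ and $\mathbb P(\mathcal E)\le\varepsilon$. $\alpha(R,Q)$ is the supremum of asynchronism exponents achievable at rate $R$, and the synchronization threshold is $\alpha(Q)=\alpha(0,Q)$. $D(\cdot\|\cdot)$ denotes Kullback–Leibler divergence (which may be $+\infty$). *)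

theory Defs
  imports "HOL-Analysis.Analysis" "HOL-Probability.Probability"
begin

text \<open>
  Discrete memoryless channel: input alphabet = finite type 'x, output alphabet = finite type 'y,
  transition law Q x = Q(.|x) (a pmf on 'y); star :: 'x is the noise symbol.
\<close>

definition KL_div :: "'y::finite pmf \<Rightarrow> 'y pmf \<Rightarrow> ereal" where
  "KL_div P P' = (\<Sum>y\<in>UNIV.
      (if pmf P y = 0 then 0
       else if pmf P' y = 0 then \<infinity>
       else ereal (pmf P y * ln (pmf P y / pmf P' y))))"

text \<open>Mutual information I(P,Q) of input distribution P and channel Q (natural log).
  Terms with P(x)Q(y|x) = 0 vanish (Isabelle's ln 0 = 0 and the zero factor).\<close>
definition mutual_info :: "'x::finite pmf \<Rightarrow> ('x \<Rightarrow> 'y::finite pmf) \<Rightarrow> real" where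
  "mutual_info P Q = (\<Sum>x\<in>UNIV. \<Sum>y\<in>UNIV.
      pmf P x * pmf (Q x) y *
      ln (pmf (Q x) y / (\<Sum>x'\<in>UNIV. pmf P x' * pmf (Q x') y)))"

definition capacity :: "('x::finite \<Rightarrow> 'y::finite pmf) \<Rightarrow> real" where
  "capacity Q = (SUP P. mutual_info P Q)"

text \<open>Channel input at (1-indexed) time i, when codeword cw starts at time l:
  cw_{i-l+1} if l \<le> i \<le> l + N - 1, otherwise star.\<close>
definition input_at :: "'x \<Rightarrow> 'x list \<Rightarrow> nat \<Rightarrow> nat \<Rightarrow> 'x" where
  "input_at star cw l i = (if l \<le> i \<and> i < l + length cw then cw ! (i - l) else star)"

definition prefix_prob :: "('x \<Rightarrow> 'y pmf) \<Rightarrow> 'x \<Rightarrow> 'x list \<Rightarrow> nat \<Rightarrow> 'y list \<Rightarrow> real" where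
  "prefix_prob Q star cw l w = (\<Prod>i<length w. pmf (Q (input_at star cw l (Suc i))) (w ! i))"

text \<open>A sequential decoder (tau, phi) is given by a stopping rule stop and a decision rule dec on
  finite output prefixes: tau = least n such that stop (Y_1..Y_n) (tau = infinity if there is none),
  phi = dec (Y_1..Y_tau). Every stopping time w.r.t. Y_1, Y_2, ... is of this form.
  The prefixes on which tau = n: \<close>
definition stops_at :: "('y list \<Rightarrow> bool) \<Rightarrow> nat \<Rightarrow> 'y::finite list set" where
  "stops_at stop n = {w. length w = n \<and> stop w \<and> (\<forall>k<n. \<not> stop (take k w))}"

definition P_stop :: "('x \<Rightarrow> 'y::finite pmf) \<Rightarrow> 'x \<Rightarrow> 'x list \<Rightarrow> nat \<Rightarrow>
    ('y list \<Rightarrow> bool) \<Rightarrow> nat \<Rightarrow> real" where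
  "P_stop Q star cw l stop n = (\<Sum>w\<in>stops_at stop n. prefix_prob Q star cw l w)"

definition P_stop_dec :: "('x \<Rightarrow> 'y::finite pmf) \<Rightarrow> 'x \<Rightarrow> 'x list \<Rightarrow> nat \<Rightarrow>
    ('y list \<Rightarrow> bool) \<Rightarrow> ('y list \<Rightarrow> nat) \<Rightarrow> nat \<Rightarrow> nat \<Rightarrow> real" where
  "P_stop_dec Q star cw l stop dec m' n =
     (\<Sum>w\<in>{w\<in>stops_at stop n. dec w = m'}. prefix_prob Q star cw l w)"

text \<open>P_{m,l}(phi \<noteq> m): one minus the probability of stopping (at a finite time) with the
  correct decision m; never stopping counts as an error.\<close>
definition P_err_ml :: "('x \<Rightarrow> 'y::finite pmf) \<Rightarrow> 'x \<Rightarrow> (nat \<Rightarrow> 'x list) \<Rightarrow>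
    ('y list \<Rightarrow> bool) \<Rightarrow> ('y list \<Rightarrow> nat) \<Rightarrow> nat \<Rightarrow> nat \<Rightarrow> real" where
  "P_err_ml Q star c stop dec m l = 1 - (\<Sum>n. P_stop_dec Q star (c m) l stop dec m n)"

text \<open>E_{m,l}(tau - l)^+ (in [0, infinity]); if tau = infinity with positive probability
  the expectation is infinite.\<close>
definition delay_ml :: "('x \<Rightarrow> 'y::finite pmf) \<Rightarrow> 'x \<Rightarrow> (nat \<Rightarrow> 'x list) \<Rightarrow>
    ('y list \<Rightarrow> bool) \<Rightarrow> nat \<Rightarrow> nat \<Rightarrow> ennreal" where
  "delay_ml Q star c stop m l =
     (\<Sum>n. ennreal (real (n - l) * P_stop Q star (c m) l stop n)) +
     (if (\<Sum>n. P_stop Q star (c m) l stop n) < 1 then \<infinity> else 0)"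

definition P_error :: "('x \<Rightarrow> 'y::finite pmf) \<Rightarrow> 'x \<Rightarrow> nat \<Rightarrow> nat \<Rightarrow> (nat \<Rightarrow> 'x list) \<Rightarrow>
    ('y list \<Rightarrow> bool) \<Rightarrow> ('y list \<Rightarrow> nat) \<Rightarrow> real" where
  "P_error Q star A M c stop dec =
     (\<Sum>m<M. \<Sum>l\<in>{1..A}. P_err_ml Q star c stop dec m l) / (real A * real M)"

definition avg_delay :: "('x \<Rightarrow> 'y::finite pmf) \<Rightarrow> 'x \<Rightarrow> nat \<Rightarrow> nat \<Rightarrow> (nat \<Rightarrow> 'x list) \<Rightarrow>
    ('y list \<Rightarrow> bool) \<Rightarrow> ennreal" where
  "avg_delay Q star A M c stop =
     (\<Sum>m<M. \<Sum>l\<in>{1..A}. delay_ml Q star c stop m l) / ennreal (real A * real M)"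

definition code_rate :: "nat \<Rightarrow> ennreal \<Rightarrow> ereal" where
  "code_rate M E = (if E = 0 then \<infinity> else if E = \<infinity> then 0
                    else ereal (ln (real M) / enn2real E))"

definition valid_code :: "nat \<Rightarrow> nat \<Rightarrow> (nat \<Rightarrow> 'x list) \<Rightarrow> ('y list \<Rightarrow> nat) \<Rightarrow> bool" where
  "valid_code N M c dec \<longleftrightarrow> M \<ge> 2 \<and> (\<forall>m<M. length (c m) = N) \<and> (\<forall>w. dec w < M)"

definition async_level :: "real \<Rightarrow> nat \<Rightarrow> nat" where
  "async_level a N = nat \<lceil>exp (a * real N)\<rceil>"

definition achievable_exponent :: "('x \<Rightarrow> 'y::finite pmf) \<Rightarrow> 'x \<Rightarrow> real \<Rightarrow> real \<Rightarrow> bool" where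
  "achievable_exponent Q star R \<alpha> \<longleftrightarrow>
     (\<forall>\<epsilon>>0. \<exists>N0. \<forall>N\<ge>N0. \<exists>M (c :: nat \<Rightarrow> 'x list) (stop :: 'y list \<Rightarrow> bool) dec.
        valid_code N M c dec \<and>
        code_rate M (avg_delay Q star (async_level (\<alpha> - \<epsilon>) N) M c stop) \<ge> ereal (R - \<epsilon>) \<and>
        P_error Q star (async_level (\<alpha> - \<epsilon>) N) M c stop dec \<le> \<epsilon>)"

definition async_exponent :: "('x \<Rightarrow> 'y::finite pmf) \<Rightarrow> 'x \<Rightarrow> real \<Rightarrow> ereal" where
  "async_exponent Q star R = Sup (ereal ` {\<alpha>. achievable_exponent Q star R \<alpha>})"

definition sync_threshold :: "('x \<Rightarrow> 'y::finite pmf) \<Rightarrow> 'x \<Rightarrow> ereal" where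
  "sync_threshold Q star = async_exponent Q star 0"

end

theory Submission
  imports Defs "HOL-Real_Asymp.Real_Asymp"
begin

text \<open>
  At rate 0 the delay constraint is void, so only the error probability matters.

  Converse: let \<open>D\<close> be the maximal divergence, \<open>\<alpha> > D\<close>, and let \<open>\<Lambda>\<^sub>l\<close> be the likelihood ratio of the
  law with start time \<open>l\<close> to the pure noise law. Truncated where the log-likelihood exceeds
  \<open>N (D + \<eta>)\<close>, which costs an exponentially small probability by a Chernoff bound, these ratios are
  bounded by \<open>exp (N (D + \<eta>))\<close>, and untruncated ones with disjoint transmission blocks are
  uncorrelated under the noise law. Hence their average over \<open>l\<close> has second moment
  at most \<open>1 + 2 N exp (N (D + \<eta>)) / A\<close>, so it is close to 1 in mean square: the output law
  averaged over the start time is nearly the noise law for every message, and no decoder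
  beats guessing.

  Achievability: the codewords are i.i.d. random words over the divergence-maximizing symbol \<open>x\<close> and
  the noise symbol, the latter rare. The decoder observes all outputs and returns a message whose codeword
  scores at least \<open>\<gamma> N\<close> in some window. The score of \<open>x\<close> is a real function \<open>g\<close> of the output with
  \<open>E exp g \<le> 1\<close> under noise and \<open>E g > \<alpha>\<close> under \<open>x\<close> (the variational characterization of the
  divergence, covering also the infinite case). Windows of pure noise are handled by Markov's inequality,
  while windows overlapping the true block, of which there are only \<open>2 N\<close> per message, see a wrong
  codeword independent of the outputs and therefore a strictly smaller mean score.
\<close>

section \<open>Finite product distributions\<close>

abbreviation expect :: "'a pmf \<Rightarrow> ('a \<Rightarrow> real) \<Rightarrow> real" where
  "expect p f \<equiv> measure_pmf.expectation p f"

text \<open>Independent letters over a finite horizon, with \<open>undefined\<close> beyond it. For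
  finitely supported letters the support is finite, so every function is integrable and infinite
  output sequences are avoided.\<close>

definition seq_pmf :: "nat \<Rightarrow> (nat \<Rightarrow> 'a pmf) \<Rightarrow> (nat \<Rightarrow> 'a) pmf" where
  "seq_pmf n p = Pi_pmf {..<n} undefined p"

lemma finite_set_seq_pmf [simp]:
  assumes "\<And>j. finite (set_pmf (p j))"
  shows "finite (set_pmf (seq_pmf n p))"
  unfolding seq_pmf_def using assms by (subst set_Pi_pmf) auto

lemma integrable_seq_pmf [simp]:
  assumes "\<And>j. finite (set_pmf (p j))"
  shows "integrable (measure_pmf (seq_pmf n p)) (f :: _ \<Rightarrow> real)"
  using assms by (intro integrable_measure_pmf_finite) simp

lemma integrable_finite_pmf [simp]: "integrable (measure_pmf (p :: 'a::finite pmf)) (f :: _ \<Rightarrow> real)"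
  by (rule integrable_measure_pmf_finite) simp

lemma expect_finite_type: "expect (p :: 'a::finite pmf) f = (\<Sum>x\<in>UNIV. pmf p x * f x)"
  by (simp add: integral_measure_pmf[where A = UNIV])

lemma expect_mono:
  assumes "finite (set_pmf p)" "\<And>x. x \<in> set_pmf p \<Longrightarrow> f x \<le> g x"
  shows "expect p f \<le> expect p g"
  using assms by (intro integral_mono_AE) (auto simp: integrable_measure_pmf_finite AE_measure_pmf_iff)

lemma expect_prod_seq_pmf:
  fixes p :: "nat \<Rightarrow> 'a::finite pmf"
  assumes "\<And>j x. j < n \<Longrightarrow> f j x \<ge> 0"
  shows "expect (seq_pmf n p) (\<lambda>y. \<Prod>j<n. f j (y j)) = (\<Prod>j<n. expect (p j) (f j))"
  unfolding seq_pmf_def using assms by (intro expectation_prod_Pi_pmf) auto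

lemma prob_le_expect:
  assumes "finite (set_pmf p)" "\<And>x. S x \<Longrightarrow> 1 \<le> f x" "\<And>x. 0 \<le> f x"
  shows "measure_pmf.prob p {x. S x} \<le> expect p f"
proof -
  have "measure_pmf.prob p {x. S x} = expect p (indicator {x. S x})"
    by simp
  also have "\<dots> \<le> expect p f"
    by (rule expect_mono) (use assms in \<open>auto simp: indicator_def\<close>)
  finally show ?thesis .
qed

text \<open>The difference of the two sides vanishes at t = 0 and has derivative
  \<open>expect p f - a\<close> < 0 there. The eventual form lets several Chernoff bounds share one
  t.\<close>

lemma eventually_mgf_le:
  fixes p :: "'a::finite pmf"
  assumes "expect p f < a"
  shows "\<forall>\<^sub>F t in at_right 0. expect p (\<lambda>x. exp (t * f x)) \<le> exp (t * a)"
proof -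
  define h where "h t = (\<Sum>x\<in>UNIV. pmf p x * exp (t * f x)) - exp (t * a)" for t
  have "(h has_real_derivative (\<Sum>x\<in>UNIV. pmf p x * f x) - a) (at 0)"
    unfolding h_def by (auto intro!: derivative_eq_intros simp: mult.commute)
  moreover have "(\<Sum>x\<in>UNIV. pmf p x * f x) - a < 0"
    using assms by (simp add: expect_finite_type)
  ultimately obtain d where "d > 0" and d: "\<And>t. 0 < t \<Longrightarrow> t < d \<Longrightarrow> h (0 + t) < h 0"
    using has_real_derivative_neg_dec_right[of h _ 0 UNIV]
    by (metis UNIV_I)
  have "h 0 = 0"
    by (simp add: h_def sum_pmf_eq_1)
  then have "expect p (\<lambda>x. exp (t * f x)) \<le> exp (t * a)" if "0 < t" "t < d" for t
    using d[OF that] by (simp add: h_def expect_finite_type)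
  then show ?thesis
    using \<open>d > 0\<close> by (auto simp: eventually_at_right_field)
qed

text \<open>Passes from sums over output words, as in the model, to probabilities. The horizon K may
  exceed n, so that words of different lengths become events of one space.\<close>

lemma sum_prod_pmf_eq_prob:
  fixes p :: "nat \<Rightarrow> 'a::finite pmf"
  assumes "n \<le> K" "S \<subseteq> {w. length w = n}"
  shows "(\<Sum>w\<in>S. \<Prod>i<n. pmf (p i) (w ! i)) =
     measure_pmf.prob (seq_pmf K p) {f. map f [0..<n] \<in> S}"
proof -
  \<comment> \<open>Inverse of reading off the first n letters, padded with the default of
    \<open>seq_pmf\<close>.\<close>
  define F where "F w = (\<lambda>i. if i < n then w ! i else undefined)" for w :: "'a list"
  have finS: "finite S"
    using assms(2) finite_lists_length_eq[of "UNIV :: 'a set" n] by (auto intro: finite_subset)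
  have map_F: "map (F w) [0..<n] = w" if "w \<in> S" for w
    using that assms(2) by (auto intro!: nth_equalityI simp: F_def)
  have inj: "inj_on F S"
    by (rule inj_on_inverseI[where g = "\<lambda>f. map f [0..<n]"]) (use map_F in simp)
  have ext: "F (map f [0..<n]) = f" if "f \<in> set_pmf (seq_pmf n p)" for f
    using that unfolding seq_pmf_def F_def
    by (subst (asm) set_Pi_pmf) (auto simp: PiE_dflt_def fun_eq_iff)
  \<comment> \<open>The law up to n is a marginal of the law up to K, and the event only looks at
    the first n letters.\<close>
  have "seq_pmf n p = map_pmf (\<lambda>f x. if x \<in> {..<n} then f x else undefined) (seq_pmf K p)"
    unfolding seq_pmf_def by (rule Pi_pmf_subset) (use assms in auto)
  then have "measure_pmf.prob (seq_pmf n p) {f. map f [0..<n] \<in> S} =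
    measure_pmf.prob (seq_pmf K p) ((\<lambda>f x. if x \<in> {..<n} then f x else undefined) -` {f. map f [0..<n] \<in> S})"
    by simp
  also have "(\<lambda>f x. if x \<in> {..<n} then f x else undefined) -` {f. map f [0..<n] \<in> S} = {f. map f [0..<n] \<in> S}"
  proof -
    have *: "map (\<lambda>x. if x < n then f x else undefined) [0..<n] = map f [0..<n]" for f :: "nat \<Rightarrow> 'a"
      by simp
    show ?thesis
      by (simp add: vimage_def *)
  qed
  finally have "measure_pmf.prob (seq_pmf K p) {f. map f [0..<n] \<in> S} =
    measure_pmf.prob (seq_pmf n p) {f. map f [0..<n] \<in> S}" ..
  also have "\<dots> = measure_pmf.prob (seq_pmf n p) (F ` S)"
    by (rule measure_pmf.finite_measure_eq_AE) (auto simp: AE_measure_pmf_iff image_iff map_F intro: ext[symmetric])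
  also have "\<dots> = (\<Sum>w\<in>S. pmf (seq_pmf n p) (F w))"
    using finS inj by (simp add: measure_measure_pmf_finite sum.reindex)
  also have "\<dots> = (\<Sum>w\<in>S. \<Prod>i<n. pmf (p i) (w ! i))"
    by (intro sum.cong refl) (simp add: seq_pmf_def pmf_Pi F_def)
  finally show ?thesis ..
qed

lemma sum_prefix_prob:
  fixes Q :: "'x \<Rightarrow> 'y::finite pmf"
  assumes "n \<le> K" "S \<subseteq> {w. length w = n}"
  shows "(\<Sum>w\<in>S. prefix_prob Q star cw l w) =
     measure_pmf.prob (seq_pmf K (\<lambda>j. Q (input_at star cw l (Suc j)))) {f. map f [0..<n] \<in> S}"
  unfolding sum_prod_pmf_eq_prob[OF assms, symmetric] prefix_prob_def
  using assms(2) by (intro sum.cong) auto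

section \<open>The output law averaged over the start time\<close>

text \<open>Both laws live on one finite set of functions, where their weights differ by the
  likelihood ratio; positivity of \<open>p\<close> makes the division legitimate.\<close>

lemma expect_change_of_measure:
  fixes p p' :: "nat \<Rightarrow> 'a::finite pmf"
  assumes "\<And>j x. pmf (p j) x > 0"
  shows "expect (seq_pmf n p') \<phi> =
    expect (seq_pmf n p) (\<lambda>f. \<phi> f * (\<Prod>j<n. pmf (p' j) (f j) / pmf (p j) (f j)))"
proof -
  define S where "S = PiE_dflt {..<n} undefined (\<lambda>_. UNIV :: 'a set)"
  have fin: "finite S"
    unfolding S_def by (intro finite_PiE_dflt) auto
  have sub: "set_pmf (seq_pmf n r) \<subseteq> S" for r
    unfolding seq_pmf_def S_def by (subst set_Pi_pmf) (auto simp: PiE_dflt_def)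
  have pmf_S: "pmf (seq_pmf n r) f = (\<Prod>j<n. pmf (r j) (f j))" if "f \<in> S" for r f
    using that unfolding seq_pmf_def S_def by (subst pmf_Pi') (auto simp: PiE_dflt_def)
  have nz: "(\<Prod>j<n. pmf (p j) (f j)) \<noteq> 0" for f
    using assms by (metis (no_types, lifting) finite_lessThan less_irrefl prod_zero_iff)
  have "expect (seq_pmf n p') \<phi> = (\<Sum>f\<in>S. pmf (seq_pmf n p') f * \<phi> f)"
    using sub fin by (subst integral_measure_pmf[where A = S]) auto
  also have "\<dots> = (\<Sum>f\<in>S. pmf (seq_pmf n p) f *
      (\<phi> f * (\<Prod>j<n. pmf (p' j) (f j) / pmf (p j) (f j))))"
    using nz by (intro sum.cong refl) (simp add: pmf_S prod_dividef)
  also have "\<dots> = expect (seq_pmf n p) (\<lambda>f. \<phi> f * (\<Prod>j<n. pmf (p' j) (f j) / pmf (p j) (f j)))"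
    using sub fin by (subst integral_measure_pmf[where A = S]) auto
  finally show ?thesis .
qed

text \<open>Indices from 0 stand for channel times from 1, hence the \<open>Suc\<close>: these are
  the positions of a codeword of length N sent from time l.\<close>

definition block :: "nat \<Rightarrow> nat \<Rightarrow> nat set" where
  "block N l = {j. l \<le> Suc j \<and> Suc j < l + N}"

lemma card_block_le:
  assumes "l \<ge> 1"
  shows "finite (block N l)" "card (block N l) \<le> N"
proof -
  have "block N l \<subseteq> {l - 1..<l - 1 + N}"
    using assms by (auto simp: block_def)
  then show "finite (block N l)" "card (block N l) \<le> N"
    using card_mono[of "{l - 1..<l - 1 + N}" "block N l"] finite_subset by auto
qed

lemma input_at_outside: "j \<notin> block (length cw) l \<Longrightarrow> input_at star cw l (Suc j) = star"
  by (auto simp: block_def input_at_def)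

lemma prod_le_power_card:
  fixes c :: real and K :: nat
  assumes "finite B" "card B \<le> N" "1 \<le> c" "\<And>j. j < K \<Longrightarrow> 0 \<le> f j"
    and "\<And>j. j < K \<Longrightarrow> f j \<le> (if j \<in> B then c else 1)"
  shows "(\<Prod>j<K. f j) \<le> c ^ N"
proof -
  have "(\<Prod>j<K. f j) \<le> (\<Prod>j<K. if j \<in> B then c else 1)"
    using assms by (intro prod_mono) auto
  also have "\<dots> = c ^ card ({..<K} \<inter> B)"
    by (simp add: prod.If_cases)
  also have "\<dots> \<le> c ^ N"
    using assms card_mono[of B "{..<K} \<inter> B"] by (intro power_increasing) auto
  finally show ?thesis .
qed

text \<open>At most 2N start times can thus interfere with a given one, the source of the factor 2N
  in the converse and in the random coding bound.\<close>

lemma block_overlap: "block N l \<inter> block N l' \<noteq> {} \<Longrightarrow> l' \<in> {l - N..<l + N}"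
  by (auto simp: block_def)

text \<open>Second moment method. With X the average of the truncated likelihood ratios, E X >= 1 -
  \<delta> and E X^2 <= 1 + 2N exp(Na)/A under noise, which makes E (X - 1)^2 small. Here a is the
  truncation level per letter, \<delta> bounds the probability lost by truncation, and s is a free
  slack. The error term does not involve K.\<close>

lemma avg_prob_le_noise_prob:
  fixes Q :: "'x \<Rightarrow> 'y::finite pmf" and star :: 'x and cw :: "'x list" and A K :: nat
    and a b t s :: real and U :: "(nat \<Rightarrow> 'y) set"
  defines "r \<equiv> \<lambda>x y. pmf (Q x) y / pmf (Q star) y"
    and "N \<equiv> length cw"
    and "P \<equiv> \<lambda>l. seq_pmf K (\<lambda>j. Q (input_at star cw l (Suc j)))"
    and "P0 \<equiv> seq_pmf K (\<lambda>_. Q star)"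
  defines "\<delta> \<equiv> exp (- (t * N * (a - b)))"
  assumes full: "\<And>y. pmf (Q star) y > 0"
    and t: "t > 0" and s: "s > 0" and A: "A \<ge> 1"
    and mgf: "\<And>x. expect (Q x) (\<lambda>y. exp (t * ln (r x y))) \<le> exp (t * b)"
  shows "(\<Sum>l\<in>{1..A}. measure_pmf.prob (P l) U) / A \<le>
    measure_pmf.prob P0 U + s + (2 * N * exp (N * a) / A + 2 * \<delta>) / (4 * s) + \<delta>"
proof -
  define z where "z l j = input_at star cw l (Suc j)" for l j
  define L where "L l f = (\<Prod>j<K. r (z l j) (f j))" for l f
  define S where "S l f = (\<Sum>j<K. ln (r (z l j) (f j)))" for l f
  define B where "B l = {f. S l f \<le> N * a}" for l
  define T where "T l f = indicator (B l) f * L l f" for l f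
  define X where "X f = (\<Sum>l\<in>{1..A}. T l f) / A" for f
  define \<theta> where "\<theta> = exp (N * a)"
  have r0: "r x y \<ge> 0" for x y
    by (simp add: r_def)
  have r_star: "r star y = 1" for y
    using full[of y] by (simp add: r_def)
  have L0: "L l f \<ge> 0" for l f
    unfolding L_def by (intro prod_nonneg) (auto simp: r0)
  have T0: "T l f \<ge> 0" and TL: "T l f \<le> L l f" for l f
    using L0 by (auto simp: T_def indicator_def)
  have change: "expect (P l) \<phi> = expect P0 (\<lambda>f. \<phi> f * L l f)" for l \<phi>
    unfolding P_def P0_def L_def r_def z_def by (rule expect_change_of_measure) (rule full)
  \<comment> \<open>Only an inequality: \<open>ln 0 = 0\<close> turns a vanishing ratio into a
    factor 1.\<close>
  have L_le_exp: "L l f \<le> exp (S l f)" for l f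
    unfolding L_def S_def exp_sum[OF finite_lessThan]
  proof (intro prod_mono conjI r0)
    show "r (z l i) (f i) \<le> exp (ln (r (z l i) (f i)))" for i
      using r0[of "z l i" "f i"] by (cases "r (z l i) (f i) = 0") auto
  qed
  have T_le: "T l f \<le> \<theta>" for l f
  proof (cases "f \<in> B l")
    case True
    have "L l f \<le> exp (N * a)"
      using L_le_exp[of l f] True by (auto simp: B_def intro: order_trans)
    then show ?thesis
      using True by (simp add: T_def \<theta>_def)
  qed (simp add: T_def \<theta>_def)
  \<comment> \<open>The noise symbol has ratio 1 throughout. The bound lets the N-th power dominate
    even when the horizon K cuts off part of the block.\<close>
  have b0: "1 \<le> exp (t * b)"
    using mgf[of star] by (simp add: r_star)
  \<comment> \<open>Chernoff bound: positions outside the block contribute the factor 1.\<close>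
  have tail: "measure_pmf.prob (P l) (- B l) \<le> \<delta>" if "l \<ge> 1" for l
  proof -
    have "measure_pmf.prob (P l) {f. \<not> S l f \<le> N * a} \<le>
        expect (P l) (\<lambda>f. exp (t * S l f - t * (N * a)))"
      by (rule prob_le_expect) (use t in \<open>auto simp: P_def\<close>)
    also have "\<dots> = expect (P l) (\<lambda>f. (\<Prod>j<K. exp (t * ln (r (z l j) (f j)))) / exp (t * (N * a)))"
      by (simp add: S_def exp_diff exp_sum sum_distrib_left)
    also have "\<dots> = expect (P l) (\<lambda>f. \<Prod>j<K. exp (t * ln (r (z l j) (f j)))) / exp (t * (N * a))"
      by simp
    also have "expect (P l) (\<lambda>f. \<Prod>j<K. exp (t * ln (r (z l j) (f j)))) =
        (\<Prod>j<K. expect (Q (z l j)) (\<lambda>y. exp (t * ln (r (z l j) y))))"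
      unfolding P_def z_def[symmetric] by (rule expect_prod_seq_pmf) simp
    also have "\<dots> \<le> exp (t * b) ^ N"
    proof (rule prod_le_power_card[OF card_block_le[OF that] b0])
      show "expect (Q (z l j)) (\<lambda>y. exp (t * ln (r (z l j) y))) \<le>
          (if j \<in> block N l then exp (t * b) else 1)" for j
      proof (cases "j \<in> block N l")
        case False
        then have "z l j = star"
          unfolding z_def N_def by (rule input_at_outside)
        then show ?thesis
          using False by (simp add: r_star)
      qed (use mgf in simp)
    qed simp
    also have "exp (t * b) ^ N / exp (t * (N * a)) = \<delta>"
      by (simp add: \<delta>_def exp_of_nat_mult[symmetric] exp_diff[symmetric] algebra_simps)
    finally show ?thesis
      by (simp add: B_def Compl_eq divide_right_mono)
  qed
  have ET: "expect P0 (T l) \<ge> 1 - \<delta>" if "l \<ge> 1" for l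
  proof -
    have "expect P0 (T l) = measure_pmf.prob (P l) (B l)"
      using change[of l "indicator (B l)"] by (simp add: T_def[abs_def])
    then show ?thesis
      using tail[OF that] measure_pmf.prob_compl[of "B l" "P l"] by (simp add: Compl_eq_Diff_UNIV)
  qed
  have EL: "expect P0 (L l) = 1" for l
    using change[of l "\<lambda>_. 1"] by simp
  \<comment> \<open>For disjoint blocks one of the two ratios is 1 at each position and the other
    has mean 1 under noise. For overlapping blocks one factor is bounded by \<open>\<theta>\<close>
    and the other has mean at most 1.\<close>
  have ETT: "expect P0 (\<lambda>f. T l f * T l' f) \<le> 1 + (if l' \<in> {l - N..<l + N} then \<theta> else 0)" for l l'
  proof (cases "block N l \<inter> block N l' = {}")
    case True
    have "expect P0 (\<lambda>f. T l f * T l' f) \<le> expect P0 (\<lambda>f. L l f * L l' f)"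
      by (intro expect_mono mult_mono TL T0 L0) (simp add: P0_def)
    also have "\<dots> = expect P0 (\<lambda>f. \<Prod>j<K. r (z l j) (f j) * r (z l' j) (f j))"
      by (simp add: L_def prod.distrib)
    also have "\<dots> = (\<Prod>j<K. expect (Q star) (\<lambda>y. r (z l j) y * r (z l' j) y))"
      unfolding P0_def by (rule expect_prod_seq_pmf) (simp add: r0)
    also have "\<dots> = 1"
    proof (rule prod.neutral, safe)
      fix j
      have one: "expect (Q star) (r x) = 1" for x
        using full by (simp add: expect_finite_type r_def less_imp_neq[symmetric] sum_pmf_eq_1)
      have "z l j = star \<or> z l' j = star"
        using True unfolding z_def N_def by (metis IntI empty_iff input_at_outside)
      then show "expect (Q star) (\<lambda>y. r (z l j) y * r (z l' j) y) = 1"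
        by (elim disjE) (simp_all add: r_star one)
    qed
    finally show ?thesis
      by (simp add: \<theta>_def add_increasing2)
  next
    case False
    have "expect P0 (\<lambda>f. T l f * T l' f) \<le> expect P0 (\<lambda>f. \<theta> * L l' f)"
      by (intro expect_mono mult_mono T_le TL T0) (simp_all add: P0_def \<theta>_def)
    also have "\<dots> = \<theta>"
      using EL by simp
    finally show ?thesis
      using block_overlap[OF False] by simp
  qed
  have EX: "expect P0 X \<ge> 1 - \<delta>"
  proof -
    have "(1 - \<delta>) * A = (\<Sum>l\<in>{1..A}. 1 - \<delta>)"
      by simp
    also have "\<dots> \<le> (\<Sum>l\<in>{1..A}. expect P0 (T l))"
      by (intro sum_mono ET) simp
    also have "\<dots> = expect P0 X * A"
      using A by (simp add: X_def[abs_def] P0_def)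
    finally show ?thesis
      using A by simp
  qed
  have EXX: "expect P0 (\<lambda>f. (X f)\<^sup>2) \<le> 1 + 2 * N * \<theta> / A"
  proof -
    have "expect P0 (\<lambda>f. (X f)\<^sup>2) = (\<Sum>l\<in>{1..A}. \<Sum>l'\<in>{1..A}. expect P0 (\<lambda>f. T l f * T l' f)) / (real A * real A)"
      by (simp add: X_def power2_eq_square sum_product P0_def)
    also have "(\<Sum>l\<in>{1..A}. \<Sum>l'\<in>{1..A}. expect P0 (\<lambda>f. T l f * T l' f))
        \<le> (\<Sum>l\<in>{1..A}. \<Sum>l'\<in>{1..A}. 1 + (if l' \<in> {l - N..<l + N} then \<theta> else 0))"
      by (intro sum_mono ETT)
    also have "\<dots> \<le> (\<Sum>l\<in>{1..A}. A + 2 * N * \<theta>)"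
    proof (rule sum_mono)
      fix l
      have "card ({1..A} \<inter> {l - N..<l + N}) \<le> card {l - N..<l + N}"
        by (rule card_mono) auto
      then have "real (card ({1..A} \<inter> {l - N..<l + N})) \<le> 2 * N"
        by simp
      moreover have "{l'. l - N \<le> l' \<and> l' < l + N} = {l - N..<l + N}"
        by auto
      ultimately show "(\<Sum>l'\<in>{1..A}. 1 + (if l' \<in> {l - N..<l + N} then \<theta> else 0)) \<le> A + 2 * N * \<theta>"
        by (simp add: sum.distrib sum.If_cases \<theta>_def)
    qed
    also have "\<dots> = real A * (A + 2 * N * \<theta>)"
      by simp
    also have "real A * (A + 2 * N * \<theta>) / (real A * real A) = 1 + 2 * N * \<theta> / A"
      using A by (simp add: field_simps)
    finally show ?thesis
      by (simp add: divide_right_mono)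
  qed
  have EXU: "expect P0 (\<lambda>f. indicator U f * X f) \<le>
      measure_pmf.prob P0 U + s + (2 * N * \<theta> / A + 2 * \<delta>) / (4 * s)"
  proof -
    \<comment> \<open>Pointwise X - 1 <= s + (X - 1)^2 / (4s), by expanding (X - 1 - 2s)^2 >= 0. The
      square is left expanded so that \<open>EX\<close> and \<open>EXX\<close> apply.\<close>
    have "expect P0 (\<lambda>f. indicator U f * X f) \<le>
        expect P0 (\<lambda>f. indicator U f + s + ((X f)\<^sup>2 - 2 * X f + 1) / (4 * s))"
    proof (rule expect_mono)
      fix f
      have "0 \<le> (X f - 1 - 2 * s)\<^sup>2 / (4 * s)"
        using s by simp
      also have "\<dots> = s + ((X f)\<^sup>2 - 2 * X f + 1) / (4 * s) - (X f - 1)"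
        using s by (simp add: field_simps power2_eq_square)
      finally have 1: "X f - 1 \<le> s + ((X f)\<^sup>2 - 2 * X f + 1) / (4 * s)"
        by simp
      have "0 \<le> (X f - 1)\<^sup>2 / (4 * s)"
        using s by simp
      then have 2: "0 \<le> s + ((X f)\<^sup>2 - 2 * X f + 1) / (4 * s)"
        using s by (simp add: power2_eq_square algebra_simps)
      show "indicator U f * X f \<le> indicator U f + s + ((X f)\<^sup>2 - 2 * X f + 1) / (4 * s)"
        using 1 2 by (cases "f \<in> U") auto
    qed (simp add: P0_def)
    also have "\<dots> = measure_pmf.prob P0 U + s +
        (expect P0 (\<lambda>f. (X f)\<^sup>2) - 2 * expect P0 X + 1) / (4 * s)"
      by (simp add: P0_def)
    also have "\<dots> \<le> measure_pmf.prob P0 U + s + (2 * N * \<theta> / A + 2 * \<delta>) / (4 * s)"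
      using EXX EX s by (intro add_left_mono divide_right_mono) auto
    finally show ?thesis .
  qed
  \<comment> \<open>Restricting U to \<open>B l\<close> costs at most \<open>\<delta>\<close>, and
    there the density with respect to noise is \<open>T l\<close>.\<close>
  have "measure_pmf.prob (P l) U \<le> expect P0 (\<lambda>f. indicator U f * T l f) + \<delta>" if "l \<ge> 1" for l
  proof -
    have "measure_pmf.prob (P l) U \<le> measure_pmf.prob (P l) (U \<inter> B l) + measure_pmf.prob (P l) (- B l)"
      by (rule order_trans[OF measure_pmf.finite_measure_mono measure_Un_le]) auto
    also have "measure_pmf.prob (P l) (U \<inter> B l) = expect P0 (\<lambda>f. indicator U f * T l f)"
      using change[of l "indicator (U \<inter> B l)"] by (simp add: T_def indicator_inter_arith mult.assoc)
    finally show ?thesis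
      using tail[OF that] by simp
  qed
  then have "(\<Sum>l\<in>{1..A}. measure_pmf.prob (P l) U) \<le>
      (\<Sum>l\<in>{1..A}. expect P0 (\<lambda>f. indicator U f * T l f) + \<delta>)"
    by (intro sum_mono) auto
  also have "\<dots> = (\<Sum>l\<in>{1..A}. expect P0 (\<lambda>f. indicator U f * T l f)) + A * \<delta>"
    by (simp add: sum.distrib)
  also have "(\<Sum>l\<in>{1..A}. expect P0 (\<lambda>f. indicator U f * T l f)) =
      expect P0 (\<lambda>f. \<Sum>l\<in>{1..A}. indicator U f * T l f)"
    unfolding P0_def by (rule Bochner_Integration.integral_sum[symmetric]) simp
  also have "(\<lambda>f. \<Sum>l\<in>{1..A}. indicator U f * T l f) = (\<lambda>f. A * (indicator U f * X f))"
    unfolding sum_distrib_left[symmetric] X_def using A by (intro ext) simp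
  finally have "(\<Sum>l\<in>{1..A}. measure_pmf.prob (P l) U) / A \<le> expect P0 (\<lambda>f. indicator U f * X f) + \<delta>"
    using A by (simp add: field_simps P0_def)
  then show ?thesis
    using EXU by (simp add: \<theta>_def)
qed

section \<open>Lower bound on the error probability\<close>

lemma stops_at_unique:
  assumes "map f [0..<n] \<in> stops_at stop n" "map f [0..<n'] \<in> stops_at stop n'"
  shows "n = n'"
proof -
  have "\<not> i < j" if "map f [0..<i] \<in> stops_at stop i" "map f [0..<j] \<in> stops_at stop j" for i j
    using that by (auto simp: stops_at_def take_map)
  then show ?thesis
    using assms by (meson linorder_neqE_nat)
qed

text \<open>One and the same set of output functions for every transmitted message and start time,
  so that its probabilities under different laws can be compared.\<close>

definition decide_event :: "('y::finite list \<Rightarrow> bool) \<Rightarrow> ('y list \<Rightarrow> nat) \<Rightarrow> nat \<Rightarrow> nat \<Rightarrow> (nat \<Rightarrow> 'y) set" where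
  "decide_event stop dec K m = {f. \<exists>n<K. map f [0..<n] \<in> stops_at stop n \<and> dec (map f [0..<n]) = m}"

lemma disjoint_decide_event: "disjoint_family_on (decide_event stop dec K) I"
  unfolding disjoint_family_on_def decide_event_def using stops_at_unique by blast

lemma sum_P_stop_dec:
  fixes Q :: "'x \<Rightarrow> 'y::finite pmf"
  shows "(\<Sum>n<K. P_stop_dec Q star cw l stop dec m n) =
    measure_pmf.prob (seq_pmf K (\<lambda>j. Q (input_at star cw l (Suc j)))) (decide_event stop dec K m)"
proof -
  let ?P = "seq_pmf K (\<lambda>j. Q (input_at star cw l (Suc j)))"
  define W where "W n = {w \<in> stops_at stop n. dec w = m}" for n
  have "(\<Sum>n<K. P_stop_dec Q star cw l stop dec m n) = (\<Sum>n<K. measure_pmf.prob ?P {f. map f [0..<n] \<in> W n})"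
    unfolding P_stop_dec_def W_def[symmetric]
    by (intro sum.cong refl sum_prefix_prob) (auto simp: W_def stops_at_def)
  also have "\<dots> = measure_pmf.prob ?P (\<Union>n<K. {f. map f [0..<n] \<in> W n})"
    by (rule measure_pmf.finite_measure_finite_Union[symmetric])
       (auto simp: disjoint_family_on_def W_def dest: stops_at_unique)
  also have "(\<Union>n<K. {f. map f [0..<n] \<in> W n}) = decide_event stop dec K m"
    by (auto simp: decide_event_def W_def)
  finally show ?thesis .
qed

lemma P_stop_dec_nonneg: "P_stop_dec Q star cw l stop dec m n \<ge> 0"
  unfolding P_stop_dec_def prefix_prob_def by (intro sum_nonneg prod_nonneg) auto

lemma summable_P_stop_dec:
  fixes Q :: "'x \<Rightarrow> 'y::finite pmf"
  shows "summable (P_stop_dec Q star cw l stop dec m)"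
  by (rule summableI_nonneg_bounded[of _ 1]) (simp_all add: P_stop_dec_nonneg sum_P_stop_dec)

lemma P_error_nonneg:
  fixes Q :: "'x \<Rightarrow> 'y::finite pmf"
  shows "P_error Q star A M c stop dec \<ge> 0"
proof -
  have "(\<Sum>n. P_stop_dec Q star cw l stop dec m n) \<le> 1" for cw l m
    by (rule suminf_le_const[OF summable_P_stop_dec]) (simp add: sum_P_stop_dec)
  then show ?thesis
    unfolding P_error_def P_err_ml_def by (intro divide_nonneg_nonneg sum_nonneg) simp_all
qed

text \<open>Under pure noise the events of deciding for the M messages are disjoint, so their
  probabilities sum to at most 1. Averaged over the start time, the true law adds at most
  \<open>\<Delta>\<close> to each, so the success probability is at most 1/M +
  \<open>\<Delta>\<close>.\<close>

lemma P_error_lower_bound: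
  fixes Q :: "'x \<Rightarrow> 'y::finite pmf" and star :: 'x and a b t s :: real and N M A :: nat
  assumes code: "valid_code N M c dec"
    and full: "\<And>y. pmf (Q star) y > 0"
    and t: "t > 0" and s: "s > 0" and A: "A \<ge> 1"
    and mgf: "\<And>x. expect (Q x) (\<lambda>y. exp (t * ln (pmf (Q x) y / pmf (Q star) y))) \<le> exp (t * b)"
  defines "\<delta> \<equiv> exp (- (t * N * (a - b)))"
  shows "P_error Q star A M c stop dec \<ge> 1 / 2 - (s + (2 * N * exp (N * a) / A + 2 * \<delta>) / (4 * s) + \<delta>)"
proof -
  define \<Delta> where "\<Delta> = s + (2 * N * exp (N * a) / A + 2 * \<delta>) / (4 * s) + \<delta>"
  have M: "M \<ge> 2" and len: "length (c m) = N" if "m < M" for m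
    using code that by (auto simp: valid_code_def)
  have M2: "M \<ge> 2"
    using code by (auto simp: valid_code_def)
  have partial: "(\<Sum>m<M. \<Sum>l\<in>{1..A}. \<Sum>n<K. P_stop_dec Q star (c m) l stop dec m n) \<le> A * (1 + M * \<Delta>)" for K
  proof -
    let ?P0 = "seq_pmf K (\<lambda>_. Q star)"
    let ?U = "decide_event stop dec K"
    have "(\<Sum>l\<in>{1..A}. \<Sum>n<K. P_stop_dec Q star (c m) l stop dec m n) \<le>
        A * (measure_pmf.prob ?P0 (?U m) + \<Delta>)" if "m < M" for m
      using avg_prob_le_noise_prob[where Q = Q and star = star and t = t and s = s and b = b and a = a
          and K = K and cw = "c m" and U = "?U m", OF full t s A mgf] A
      by (simp add: sum_P_stop_dec len[OF that] \<Delta>_def \<delta>_def divide_le_eq mult.commute algebra_simps)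
    then have "(\<Sum>m<M. \<Sum>l\<in>{1..A}. \<Sum>n<K. P_stop_dec Q star (c m) l stop dec m n) \<le>
        (\<Sum>m<M. A * (measure_pmf.prob ?P0 (?U m) + \<Delta>))"
      by (intro sum_mono) auto
    also have "\<dots> = A * ((\<Sum>m<M. measure_pmf.prob ?P0 (?U m)) + M * \<Delta>)"
      by (simp add: sum_distrib_left sum.distrib algebra_simps)
    also have "(\<Sum>m<M. measure_pmf.prob ?P0 (?U m)) = measure_pmf.prob ?P0 (\<Union>m<M. ?U m)"
      by (rule measure_pmf.finite_measure_finite_Union[symmetric]) (auto simp: disjoint_decide_event)
    also have "A * (measure_pmf.prob ?P0 (\<Union>m<M. ?U m) + M * \<Delta>) \<le> A * (1 + M * \<Delta>)"
      by (intro mult_left_mono add_right_mono) auto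
    finally show ?thesis .
  qed
  \<comment> \<open>The bound \<open>partial\<close> is uniform in K, so it survives the limit,
    which covers unbounded stopping times.\<close>
  have "(\<lambda>K. \<Sum>m<M. \<Sum>l\<in>{1..A}. \<Sum>n<K. P_stop_dec Q star (c m) l stop dec m n) \<longlonglongrightarrow>
      (\<Sum>m<M. \<Sum>l\<in>{1..A}. \<Sum>n. P_stop_dec Q star (c m) l stop dec m n)"
    by (intro tendsto_sum summable_LIMSEQ summable_P_stop_dec)
  then have "(\<Sum>m<M. \<Sum>l\<in>{1..A}. \<Sum>n. P_stop_dec Q star (c m) l stop dec m n) \<le> A * (1 + M * \<Delta>)"
    by (rule LIMSEQ_le_const2) (use partial in auto)
  then have "P_error Q star A M c stop dec * (real A * real M) \<ge> real A * real M - A * (1 + M * \<Delta>)"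
    using A M2 by (simp add: P_error_def P_err_ml_def sum_subtractf)
  also have "real A * real M - A * (1 + M * \<Delta>) = (1 - 1 / M - \<Delta>) * (real A * real M)"
    using M2 by (simp add: field_simps)
  finally have "P_error Q star A M c stop dec \<ge> 1 - 1 / M - \<Delta>"
    using A M2 by simp
  moreover have "1 / real M \<le> 1 / 2"
    using M2 by (intro divide_left_mono) auto
  ultimately show ?thesis
    unfolding \<Delta>_def by linarith
qed

section \<open>Divergence and the converse\<close>

lemma KL_div_infinite:
  assumes "pmf P y > 0" "pmf P' y = 0"
  shows "KL_div P P' = \<infinity>"
  unfolding KL_div_def using assms
  by (subst sum_Pinfty) (auto intro!: exI[of _ y])

lemma KL_div_finite:
  assumes "\<And>y. pmf P y > 0 \<Longrightarrow> pmf P' y > 0"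
  shows "KL_div P P' = ereal (expect P (\<lambda>y. ln (pmf P y / pmf P' y)))"
proof -
  have "(if pmf P y = 0 then 0 else if pmf P' y = 0 then \<infinity> else ereal (pmf P y * ln (pmf P y / pmf P' y))) =
      ereal (pmf P y * ln (pmf P y / pmf P' y))" for y
    using assms[of y] pmf_pos[of P y] by (cases "pmf P y = 0") (auto simp: zero_ereal_def)
  then show ?thesis
    unfolding KL_div_def expect_finite_type by simp
qed

text \<open>Gibbs' inequality: ln z <= z - 1 at z = P' y / P y bounds each term below by P y - P' y,
  strictly where the laws differ, and these lower bounds sum to 0. Without absolute continuity the
  divergence is infinite.\<close>

lemma KL_div_pos:
  assumes "P \<noteq> P'"
  shows "KL_div P P' > 0"
proof (cases "\<forall>y. pmf P y > 0 \<longrightarrow> pmf P' y > 0")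
  case True
  let ?t = "\<lambda>y. pmf P y * ln (pmf P y / pmf P' y)"
  have strict: "pmf P y - pmf P' y < ?t y" if "pmf P y \<noteq> pmf P' y" for y
  proof (cases "pmf P y = 0")
    case False
    then have "pmf P y > 0"
      by (simp add: pmf_pos)
    with True have P: "pmf P y > 0" "pmf P' y > 0"
      by blast+
    define z where "z = pmf P' y / pmf P y"
    have "z > 0" "z \<noteq> 1"
      using P that by (auto simp: z_def)
    then have "ln z < z - 1"
      using ln_le_minus_one[of z] ln_eq_minus_one[of z] by linarith
    then have "ln (pmf P' y / pmf P y) < pmf P' y / pmf P y - 1"
      by (simp only: z_def)
    then have "pmf P y * ln (pmf P' y / pmf P y) < pmf P y * (pmf P' y / pmf P y - 1)"
      using P by simp
    then show ?thesis
      using P by (simp add: ln_div algebra_simps)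
  qed (use that pmf_pos[of P' y] in simp)
  have weak: "pmf P y - pmf P' y \<le> ?t y" for y
  proof (cases "pmf P y = pmf P' y")
    case True
    then show ?thesis
      by (cases "pmf P' y = 0") simp_all
  qed (use strict[of y] in simp)
  obtain y where "pmf P y \<noteq> pmf P' y"
    using assms by (auto simp: pmf_eq_iff)
  then have "(\<Sum>y\<in>UNIV. pmf P y - pmf P' y) < (\<Sum>y\<in>UNIV. ?t y)"
    by (intro sum_strict_mono_ex1 ballI weak bexI[of _ y] strict) auto
  moreover have "(\<Sum>y\<in>UNIV. pmf P y - pmf P' y) = 0"
    by (simp add: sum_subtractf sum_pmf_eq_1)
  ultimately show ?thesis
    using True by (simp add: KL_div_finite expect_finite_type)
next
  case False
  then obtain y where "pmf P y > 0" "\<not> pmf P' y > 0"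
    by auto
  then show ?thesis
    using KL_div_infinite[of P y P'] pmf_nonneg[of P' y] by (simp add: not_less)
qed

text \<open>Through this fact positive capacity yields a letter whose output law differs from
  noise.\<close>

lemma capacity_const: "capacity (\<lambda>_ :: 'x::finite. (q :: 'y::finite pmf)) = 0"
proof -
  have "mutual_info P (\<lambda>_ :: 'x. q) = 0" for P
  proof -
    have [simp]: "c * pmf q y * ln (pmf q y / pmf q y) = 0" for c y
      by (cases "pmf q y = 0") auto
    show ?thesis
      unfolding mutual_info_def sum_distrib_right[symmetric] sum_pmf_eq_1[OF finite subset_UNIV] mult_1
      by (intro sum.neutral ballI) simp
  qed
  then show ?thesis
    by (simp add: capacity_def)
qed

text \<open>The rate R is arbitrary because the error requirement alone fails above the maximal
  divergence: for suitable large N the error exceeds 3/8, against a promised \<epsilon> <=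
  1/8.\<close>

lemma achievable_exponent_le:
  fixes Q :: "'x::finite \<Rightarrow> 'y::finite pmf"
  assumes reach: "\<forall>y. \<exists>x. pmf (Q x) y > 0"
    and ach: "achievable_exponent Q star R \<alpha>"
  shows "ereal \<alpha> \<le> (MAX x\<in>UNIV. KL_div (Q x) (Q star))"
proof (rule ccontr)
  assume "\<not> ereal \<alpha> \<le> (MAX x\<in>UNIV. KL_div (Q x) (Q star))"
  then have less: "KL_div (Q x) (Q star) < ereal \<alpha>" for x
    by (subst (asm) not_le, subst (asm) Max_less_iff) auto
  \<comment> \<open>A reachable output that noise cannot produce would make some divergence
    infinite.\<close>
  have full: "pmf (Q star) y > 0" for y
  proof -
    obtain x where "pmf (Q x) y > 0"
      using reach by blast
    then show ?thesis
      using KL_div_infinite[of "Q x" y "Q star"] less[of x] pmf_pos[of "Q star" y] by force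
  qed
  let ?r = "\<lambda>x y. ln (pmf (Q x) y / pmf (Q star) y)"
  define D where "D = Max (range (\<lambda>x. expect (Q x) (?r x)))"
  have D: "expect (Q x) (?r x) \<le> D" for x
    unfolding D_def by (intro Max_ge) auto
  have "D \<in> range (\<lambda>x. expect (Q x) (?r x))"
    unfolding D_def by (intro Max_in) auto
  then have "D < \<alpha>"
    using less by (auto simp: KL_div_finite full)
  \<comment> \<open>The gap is split in four: D + g serves the moment generating functions, D + 2g
    is the truncation level, and A grows at least like exp(N (D + 3g)).\<close>
  define g where "g = (\<alpha> - D) / 4"
  define \<epsilon> where "\<epsilon> = min g (1/8)"
  have g: "g > 0"
    using \<open>D < \<alpha>\<close> by (simp add: g_def)
  have "\<forall>\<^sub>F t in at_right 0. t > 0 \<and> (\<forall>x. expect (Q x) (\<lambda>y. exp (t * ?r x y)) \<le> exp (t * (D + g)))"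
  proof (intro eventually_conj eventually_all_finite eventually_mgf_le)
    show "\<forall>\<^sub>F t in at_right 0. t > (0::real)"
      by (rule eventually_at_right_less)
    show "expect (Q x) (?r x) < D + g" for x
      using D[of x] g by simp
  qed
  then obtain t where t: "t > 0" and mgf: "\<And>x. expect (Q x) (\<lambda>y. exp (t * ?r x y)) \<le> exp (t * (D + g))"
    using eventually_happens'[OF trivial_limit_at_right_real] by blast
  define A where "A = async_level (\<alpha> - \<epsilon>)"
  \<comment> \<open>An upper bound for the loss in \<open>P_error_lower_bound\<close> at s = 1/16,
    whence the factor 4 = 1/(4s).\<close>
  define \<Delta> where "\<Delta> N = 1/16 + (2 * N * exp (- (N * g)) + 2 * exp (- (t * N * g))) * 4 + exp (- (t * N * g))" for N :: nat
  have A1: "A N \<ge> 1" and A_ge: "exp (N * (D + 2 * g)) / A N \<le> exp (- (N * g))" for N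
  proof -
    have "exp ((\<alpha> - \<epsilon>) * N) \<le> A N"
      unfolding A_def async_level_def by linarith
    then show "A N \<ge> 1"
      using exp_gt_zero[of "(\<alpha> - \<epsilon>) * N"] by linarith
    have "exp (N * (D + 2 * g)) \<le> exp (- (N * g)) * exp ((\<alpha> - \<epsilon>) * N)"
    proof -
      have "N * (D + 3 * g) \<le> N * (\<alpha> - \<epsilon>)"
        by (intro mult_left_mono) (auto simp: \<epsilon>_def g_def field_simps min_def)
      then show ?thesis
        by (simp add: exp_add[symmetric] algebra_simps)
    qed
    also have "\<dots> \<le> exp (- (N * g)) * A N"
      using \<open>exp ((\<alpha> - \<epsilon>) * N) \<le> A N\<close> by simp
    finally show "exp (N * (D + 2 * g)) / A N \<le> exp (- (N * g))"
      using \<open>A N \<ge> 1\<close> by (simp add: divide_le_eq)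
  qed
  have "\<Delta> \<longlonglongrightarrow> 1/16"
  proof -
    define h where "h = t * g"
    have "h > 0" and "t * real N * g = h * N" for N
      using g t by (simp_all add: h_def)
    then have *: "(\<lambda>N. exp (- (t * real N * g))) \<longlonglongrightarrow> 0"
      by (simp only:) real_asymp
    have "(\<lambda>N. real (2 * N) * exp (- (real N * g))) \<longlonglongrightarrow> 0"
      using g by real_asymp
    then have "\<Delta> \<longlonglongrightarrow> 1/16 + (0 + 2 * 0) * 4 + 0"
      unfolding \<Delta>_def by (intro tendsto_intros *)
    then show ?thesis
      by simp
  qed
  then have "\<forall>\<^sub>F N in sequentially. \<Delta> N < 1/8"
    by (rule order_tendstoD) simp
  moreover obtain N0 where N0: "\<And>N. N \<ge> N0 \<Longrightarrow> \<exists>M c stop dec. valid_code N M c dec \<and>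
      P_error Q star (A N) M c stop dec \<le> \<epsilon>"
  proof -
    have "\<epsilon> > 0"
      using g by (simp add: \<epsilon>_def)
    then show ?thesis
      using ach[unfolded achievable_exponent_def, rule_format, of \<epsilon>] that unfolding A_def by meson
  qed
  ultimately obtain N where "\<Delta> N < 1/8" "N \<ge> N0"
    using eventually_happens'[OF sequentially_bot eventually_conj[OF _ eventually_ge_at_top[of N0]]] by blast
  then obtain M c stop dec where code: "valid_code N M c dec" and err: "P_error Q star (A N) M c stop dec \<le> \<epsilon>"
    using N0 by blast
  have "8 * (N * exp (N * (D + 2 * g))) / A N \<le> 8 * (N * exp (- (N * g)))"
    using mult_left_mono[OF A_ge, of "8 * N" N] by (simp add: mult.assoc)
  then have "P_error Q star (A N) M c stop dec \<ge> 1/2 - \<Delta> N"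
    using P_error_lower_bound[where Q = Q and star = star and b = "D + g"
        and a = "D + 2 * g" and s = "1/16" and c = c and stop = stop, OF code full t _ A1[of N] mgf]
    by (simp add: \<Delta>_def) 
  then show False
    using err \<open>\<Delta> N < 1/8\<close> by (simp add: \<epsilon>_def)
qed

section \<open>Random codes\<close>

lemma expect_Pi_pmf_component:
  assumes "finite I" "m \<in> I"
  shows "expect (Pi_pmf I d (\<lambda>_. q)) (\<lambda>c. \<phi> (c m)) = expect q \<phi>"
proof -
  have "expect (map_pmf (\<lambda>c. c m) (Pi_pmf I d (\<lambda>_. q))) \<phi> = expect q \<phi>"
    using assms by (simp only: Pi_pmf_component if_True)
  then show ?thesis
    by simp
qed

text \<open>Component m is drawn first, and m' is still distributed as q among the remaining ones.
  This is what makes the output independent of a wrong codeword.\<close>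

lemma expect_Pi_pmf_two_components:
  assumes "finite I" "m \<in> I" "m' \<in> I" "m \<noteq> m'" "finite (set_pmf q)"
  shows "expect (Pi_pmf I d (\<lambda>_. q)) (\<lambda>c. \<psi> (c m) (c m')) = expect q (\<lambda>u. expect q (\<psi> u))"
proof -
  define J where "J = I - {m}"
  have J: "finite J" "m \<notin> J" "I = insert m J" "m' \<in> J"
    using assms by (auto simp: J_def)
  have fin: "finite (set_pmf (Pi_pmf J d (\<lambda>_. q)))"
    using assms J by (subst set_Pi_pmf) auto
  have "expect (Pi_pmf I d (\<lambda>_. q)) (\<lambda>c. \<psi> (c m) (c m')) =
      expect (q \<bind> (\<lambda>u. map_pmf (\<lambda>f. f(m := u)) (Pi_pmf J d (\<lambda>_. q)))) (\<lambda>c. \<psi> (c m) (c m'))"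
    using J by (simp add: Pi_pmf_insert' map_pmf_def)
  also have "\<dots> = (\<Sum>u\<in>set_pmf q. pmf q u * expect (Pi_pmf J d (\<lambda>_. q)) (\<lambda>c. \<psi> u (c m')))"
    using assms fin by (subst pmf_expectation_bind[of "set_pmf q"]) auto
  also have "\<dots> = (\<Sum>u\<in>set_pmf q. pmf q u * expect q (\<psi> u))"
    using J by (simp add: expect_Pi_pmf_component)
  also have "\<dots> = expect q (\<lambda>u. expect q (\<psi> u))"
    using assms by (subst integral_measure_pmf[of "set_pmf q"]) auto
  finally show ?thesis .
qed

section \<open>Expectations over a random codeword\<close>

lemma block_eq: "l \<ge> 1 \<Longrightarrow> block N l = {l - 1..<l - 1 + N}"
  by (auto simp: block_def)

lemma prod_block:
  fixes c :: real
  assumes "l \<ge> 1" "l + N \<le> Suc T"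
  shows "(\<Prod>j<T. if j \<in> block N l then c else 1) = c ^ N"
proof -
  have "{..<T} \<inter> block N l = {l - 1..<l - 1 + N}"
    using assms by (auto simp: block_eq)
  then show ?thesis
    by (simp add: prod.If_cases)
qed

text \<open>Positions in the block carry independent letters, all others carry \<open>star\<close>,
  so the expectation factorizes. The hypothesis l + N <= T + 1 keeps the block inside the
  horizon.\<close>

lemma expect_random_codeword:
  fixes p :: "'x::finite pmf" and H :: "nat \<Rightarrow> 'x \<Rightarrow> real"
  assumes l: "l \<ge> 1" "l + N \<le> Suc T" and H: "\<And>j x. H j x \<ge> 0"
  shows "expect (seq_pmf N (\<lambda>_. p)) (\<lambda>u. \<Prod>j<T. H j (input_at star (map u [0..<N]) l (Suc j))) =
    (\<Prod>j<T. if j \<in> block N l then expect p (H j) else H j star)"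
proof -
  \<comment> \<open>Letter i of the codeword sits at position i + k.\<close>
  define k where "k = l - 1"
  have split: "(\<Prod>j<T. \<phi> j) = (\<Prod>j\<in>{..<T} - block N l. \<phi> j) * (\<Prod>i<N. \<phi> (i + k))" for \<phi> :: "nat \<Rightarrow> real"
  proof -
    have "block N l = {0 + k..<N + k}"
      using l by (auto simp: block_eq k_def)
    then have "(\<Prod>i<N. \<phi> (i + k)) = (\<Prod>j\<in>block N l. \<phi> j)"
      by (simp only: prod.shift_bounds_nat_ivl lessThan_atLeast0)
    moreover have "block N l \<subseteq> {..<T}"
      using l by (auto simp: block_eq)
    ultimately show ?thesis
      using prod.subset_diff[of "block N l" "{..<T}" \<phi>] by simp
  qed
  have "expect (seq_pmf N (\<lambda>_. p)) (\<lambda>u. \<Prod>j<T. H j (input_at star (map u [0..<N]) l (Suc j))) =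
      expect (seq_pmf N (\<lambda>_. p)) (\<lambda>u. (\<Prod>j\<in>{..<T} - block N l. H j star) * (\<Prod>i<N. H (i + k) (u i)))"
  proof (rule arg_cong[of _ _ "expect _"], rule ext, subst split, intro arg_cong2[of _ _ _ _ "(*)"] prod.cong refl)
    show "H j (input_at star (map u [0..<N]) l (Suc j)) = H j star" if "j \<in> {..<T} - block N l" for j u
      using that by (simp add: input_at_outside)
    show "H (i + k) (input_at star (map u [0..<N]) l (Suc (i + k))) = H (i + k) (u i)" if "i \<in> {..<N}" for i u
      using that l by (simp add: input_at_def k_def)
  qed
  also have "\<dots> = (\<Prod>j\<in>{..<T} - block N l. H j star) * (\<Prod>i<N. expect p (H (i + k)))"
    using H expect_prod_seq_pmf[of N "\<lambda>i. H (i + k)" "\<lambda>_. p"] by simp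
  also have "\<dots> = (\<Prod>j<T. if j \<in> block N l then expect p (H j) else H j star)"
  proof (subst split, intro arg_cong2[of _ _ _ _ "(*)"] prod.cong refl)
    show "expect p (H (i + k)) = (if i + k \<in> block N l then expect p (H (i + k)) else H (i + k) star)"
      if "i \<in> {..<N}" for i
    proof -
      have "i + k \<in> block N l"
        using that l by (auto simp: block_def k_def)
      then show ?thesis
        by simp
    qed
  qed auto
  finally show ?thesis .
qed

text \<open>Meant for thresholds a1 < \<gamma> < a2. \<open>noise\<close> serves windows of pure
  noise, \<open>cross\<close> a wrong letter scored against noise or against the output of an
  independent sent letter, and \<open>own\<close> the sent letter. T = A + N leaves room for every
  block.\<close>

locale random_code =
  fixes Q :: "'x::finite \<Rightarrow> 'y::finite pmf" and star :: 'x and p :: "'x pmf"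
    and g :: "'x \<Rightarrow> 'y \<Rightarrow> real" and t a1 a2 \<gamma> :: real and A N T :: nat
  assumes g_star: "g star y = 0"
    and t: "t > 0" and A: "A \<ge> 1" and T: "T = A + N"
    and noise: "expect (Q star) (\<lambda>y. exp (g x y)) \<le> 1"
    and cross: "expect p (\<lambda>x'. expect (Q star) (\<lambda>y. exp (t * g x' y))) \<le> exp (t * a1)"
      "expect p (\<lambda>x. expect p (\<lambda>x'. expect (Q x) (\<lambda>y. exp (t * g x' y)))) \<le> exp (t * a1)"
    and own: "expect p (\<lambda>x. expect (Q x) (\<lambda>y. exp (- (t * g x y)))) \<le> exp (- (t * a2))"
begin

definition sent :: "(nat \<Rightarrow> 'x) \<Rightarrow> nat \<Rightarrow> nat \<Rightarrow> 'x" where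
  "sent u l j = input_at star (map u [0..<N]) l (Suc j)"

definition output_pmf :: "(nat \<Rightarrow> 'x) \<Rightarrow> nat \<Rightarrow> (nat \<Rightarrow> 'y) pmf" where
  "output_pmf u l = seq_pmf T (\<lambda>j. Q (sent u l j))"

text \<open>The sum runs over the whole horizon, but \<open>g_star\<close> leaves only the window of
  length N at l.\<close>

definition score :: "(nat \<Rightarrow> 'x) \<Rightarrow> nat \<Rightarrow> (nat \<Rightarrow> 'y) \<Rightarrow> real" where
  "score u l f = (\<Sum>j<T. g (sent u l j) (f j))"

definition word_pmf :: "(nat \<Rightarrow> 'x) pmf" where
  "word_pmf = seq_pmf N (\<lambda>_. p)"

lemma sent_outside: "j \<notin> block N l \<Longrightarrow> sent u l j = star"
  unfolding sent_def by (rule input_at_outside) simp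

lemma finite_word_pmf [simp]: "finite (set_pmf word_pmf)"
  by (simp add: word_pmf_def)

lemma integrable_word_pmf [simp]: "integrable word_pmf (f :: _ \<Rightarrow> real)"
  by (simp add: word_pmf_def)

lemma integrable_output_pmf [simp]: "integrable (output_pmf u l) (f :: _ \<Rightarrow> real)"
  by (simp add: output_pmf_def)

lemma finite_output_pmf [simp]: "finite (set_pmf (output_pmf u l))"
  by (simp add: output_pmf_def)

lemma expect_exp_score:
  "expect (output_pmf u l) (\<lambda>f. exp (s * score u' l' f)) =
    (\<Prod>j<T. expect (Q (sent u l j)) (\<lambda>y. exp (s * g (sent u' l' j) y)))"
  unfolding output_pmf_def score_def sum_distrib_left exp_sum[OF finite_lessThan]
  by (rule expect_prod_seq_pmf) simp

lemma chernoff_upper: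
  assumes "s > 0"
  shows "measure_pmf.prob (output_pmf u l) {f. \<gamma> * N \<le> score u' l' f} \<le>
    exp (- (s * (\<gamma> * N))) * (\<Prod>j<T. expect (Q (sent u l j)) (\<lambda>y. exp (s * g (sent u' l' j) y)))"
proof -
  have "measure_pmf.prob (output_pmf u l) {f. \<gamma> * N \<le> score u' l' f} \<le>
      expect (output_pmf u l) (\<lambda>f. exp (- (s * (\<gamma> * N))) * exp (s * score u' l' f))"
    by (rule prob_le_expect) (use assms in \<open>auto simp flip: exp_add\<close>)
  then show ?thesis
    by (simp add: expect_exp_score)
qed

text \<open>Chernoff bound for the lower tail: averaging over the word turns each block position
  into the quantity bounded by \<open>own\<close>, and all other positions score 0.\<close>

lemma own_failure:
  assumes l: "1 \<le> l" "l \<le> A"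
  shows "expect word_pmf (\<lambda>u. measure_pmf.prob (output_pmf u l) {f. score u l f < \<gamma> * N}) \<le>
    exp (- (t * N * (a2 - \<gamma>)))"
proof -
  let ?H = "\<lambda>x. expect (Q x) (\<lambda>y. exp (- (t * g x y)))"
  have "measure_pmf.prob (output_pmf u l) {f. score u l f < \<gamma> * N} \<le>
      exp (t * (\<gamma> * N)) * (\<Prod>j<T. ?H (sent u l j))" for u
  proof -
    have "measure_pmf.prob (output_pmf u l) {f. score u l f < \<gamma> * N} \<le>
        expect (output_pmf u l) (\<lambda>f. exp (t * (\<gamma> * N)) * exp (- t * score u l f))"
      by (rule prob_le_expect) (use t in \<open>auto simp flip: exp_add\<close>)
    also have "\<dots> = exp (t * (\<gamma> * N)) * (\<Prod>j<T. ?H (sent u l j))"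
      using expect_exp_score[of u l "- t" u l] by simp
    finally show ?thesis .
  qed
  then have "expect word_pmf (\<lambda>u. measure_pmf.prob (output_pmf u l) {f. score u l f < \<gamma> * N}) \<le>
      expect word_pmf (\<lambda>u. exp (t * (\<gamma> * N)) * (\<Prod>j<T. ?H (sent u l j)))"
    by (intro expect_mono) auto
  also have "\<dots> = exp (t * (\<gamma> * N)) * expect word_pmf (\<lambda>u. \<Prod>j<T. ?H (sent u l j))"
    by simp
  also have "expect word_pmf (\<lambda>u. \<Prod>j<T. ?H (sent u l j)) =
      (\<Prod>j<T. if j \<in> block N l then expect p ?H else ?H star)"
    unfolding word_pmf_def sent_def
    by (rule expect_random_codeword[of l N T "\<lambda>_. ?H"]) (use l T in auto)
  also have "(\<Prod>j<T. if j \<in> block N l then expect p ?H else ?H star) = expect p ?H ^ N"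
    using l T by (simp add: g_star prod_block cong: if_cong)
  also have "exp (t * (\<gamma> * N)) * expect p ?H ^ N \<le> exp (t * (\<gamma> * N)) * exp (- (t * a2)) ^ N"
    by (intro mult_left_mono power_mono own) (auto intro!: integral_nonneg)
  also have "\<dots> = exp (- (t * N * (a2 - \<gamma>)))"
    by (simp flip: exp_of_nat_mult exp_add add: algebra_simps)
  finally show ?thesis .
qed

text \<open>Whatever the overlap, each of the N positions of window l' sees either noise or the
  output of an independent sent letter, and one of the two \<open>cross\<close> bounds gives the
  factor exp(t a1).\<close>

lemma false_alarm_overlap:
  assumes l: "1 \<le> l" "l \<le> A" "1 \<le> l'" "l' \<le> A"
  shows "expect word_pmf (\<lambda>u. expect word_pmf (\<lambda>u'. measure_pmf.prob (output_pmf u l) {f. \<gamma> * N \<le> score u' l' f})) \<le>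
    exp (- (t * N * (\<gamma> - a1)))"
proof -
  define F where "F x' x = expect (Q x) (\<lambda>y. exp (t * g x' y))" for x' x
  define G where "G x = expect p (\<lambda>x'. F x' x)" for x
  have F_nonneg: "F x' x \<ge> 0" and F_star: "F star x = 1" for x x'
    by (simp_all add: F_def g_star)
  have G_nonneg: "G x \<ge> 0" for x
    by (simp add: G_def F_nonneg)
  let ?e = "exp (- (t * (\<gamma> * N)))"
  have "expect word_pmf (\<lambda>u. expect word_pmf (\<lambda>u'. measure_pmf.prob (output_pmf u l) {f. \<gamma> * N \<le> score u' l' f})) \<le>
      expect word_pmf (\<lambda>u. expect word_pmf (\<lambda>u'. ?e * (\<Prod>j<T. F (sent u' l' j) (sent u l j))))"
    unfolding F_def using t by (intro expect_mono chernoff_upper) auto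
  \<comment> \<open>The wrong word is averaged first, with the sent word and hence the output law
    fixed.\<close>
  also have "\<dots> = expect word_pmf (\<lambda>u. ?e * (\<Prod>j<T. if j \<in> block N l' then G (sent u l j) else 1))"
  proof (rule arg_cong[of _ _ "expect word_pmf"], rule ext)
    fix u
    have "expect word_pmf (\<lambda>u'. \<Prod>j<T. F (sent u' l' j) (sent u l j)) =
        (\<Prod>j<T. if j \<in> block N l' then expect p (\<lambda>x'. F x' (sent u l j)) else F star (sent u l j))"
      unfolding word_pmf_def sent_def[of _ l']
      by (rule expect_random_codeword[of l' N T "\<lambda>j x'. F x' (sent u l j)"]) (use l T F_nonneg in auto)
    then show "expect word_pmf (\<lambda>u'. ?e * (\<Prod>j<T. F (sent u' l' j) (sent u l j))) =
        ?e * (\<Prod>j<T. if j \<in> block N l' then G (sent u l j) else 1)"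
      by (simp add: G_def F_star cong: if_cong)
  qed
  also have "\<dots> = ?e * expect word_pmf (\<lambda>u. \<Prod>j<T. if j \<in> block N l' then G (sent u l j) else 1)"
    by simp
  also have "expect word_pmf (\<lambda>u. \<Prod>j<T. if j \<in> block N l' then G (sent u l j) else 1) =
      (\<Prod>j<T. if j \<in> block N l then expect p (\<lambda>x. if j \<in> block N l' then G x else 1)
        else if j \<in> block N l' then G star else 1)"
    unfolding word_pmf_def sent_def
    by (rule expect_random_codeword[of l N T "\<lambda>j x. if j \<in> block N l' then G x else 1"])
       (use l T G_nonneg in auto)
  also have "\<dots> \<le> (\<Prod>j<T. if j \<in> block N l' then exp (t * a1) else 1)"
    using cross by (intro prod_mono) (auto simp: G_def F_def)
  also have "\<dots> = exp (t * a1) ^ N"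
    using l T by (intro prod_block) auto
  also have "?e * exp (t * a1) ^ N = exp (- (t * N * (\<gamma> - a1)))"
    by (simp flip: exp_of_nat_mult exp_add add: algebra_simps)
  finally show ?thesis
    by simp
qed

text \<open>Markov's inequality for exp(score), whose mean is at most 1 by \<open>noise\<close>. It
  holds for each fixed pair of words, and the decay exp(-\<gamma> N) has to pay for A
  windows.\<close>

lemma false_alarm_noise:
  assumes "block N l \<inter> block N l' = {}"
  shows "measure_pmf.prob (output_pmf u l) {f. \<gamma> * N \<le> score u' l' f} \<le> exp (- (\<gamma> * N))"
proof -
  have "(\<Prod>j<T. expect (Q (sent u l j)) (\<lambda>y. exp (1 * g (sent u' l' j) y))) \<le> 1"
  proof (rule prod_le_1, safe)
    fix j
    have "sent u l j = star \<or> sent u' l' j = star"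
      using assms sent_outside by blast
    then show "expect (Q (sent u l j)) (\<lambda>y. exp (1 * g (sent u' l' j) y)) \<le> 1"
      using noise by (elim disjE) (simp_all add: g_star)
  qed simp
  then have "exp (- (1 * (\<gamma> * N))) * (\<Prod>j<T. expect (Q (sent u l j)) (\<lambda>y. exp (1 * g (sent u' l' j) y))) \<le>
      exp (- (1 * (\<gamma> * N))) * 1"
    by (intro mult_left_mono) auto
  from order_trans[OF chernoff_upper[OF zero_less_one] this] show ?thesis
    by simp
qed

section \<open>The threshold decoder and its error events\<close>

definition hit :: "(nat \<Rightarrow> 'x) \<Rightarrow> 'y list \<Rightarrow> bool" where
  "hit u w \<longleftrightarrow> (\<exists>l\<in>{1..A}. \<gamma> * N \<le> score u l (\<lambda>j. w ! j))"

text \<open>Ties are broken arbitrarily and 0 is a default; both matter only inside the events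
  counted by \<open>err\<close>.\<close>

definition dec :: "nat \<Rightarrow> (nat \<Rightarrow> nat \<Rightarrow> 'x) \<Rightarrow> 'y list \<Rightarrow> nat" where
  "dec M c w = (if \<exists>m<M. hit (c m) w then SOME m. m < M \<and> hit (c m) w else 0)"

lemma dec_less: "M > 0 \<Longrightarrow> dec M c w < M"
  unfolding dec_def by (auto intro: someI2_ex)

lemma dec_eq:
  assumes "m < M" "hit (c m) w" "\<And>m'. m' < M \<Longrightarrow> m' \<noteq> m \<Longrightarrow> \<not> hit (c m') w"
  shows "dec M c w = m"
  using assms unfolding dec_def by (auto intro!: some_equality)

lemma hit_map: "hit u (map f [0..<T]) \<longleftrightarrow> (\<exists>l\<in>{1..A}. \<gamma> * N \<le> score u l f)"
  by (simp add: hit_def score_def)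

definition err :: "nat \<Rightarrow> (nat \<Rightarrow> nat \<Rightarrow> 'x) \<Rightarrow> nat \<Rightarrow> nat \<Rightarrow> real" where
  "err M c m l = measure_pmf.prob (output_pmf (c m) l) {f. score (c m) l f < \<gamma> * N} +
    (\<Sum>m'\<in>{..<M} - {m}. \<Sum>l'\<in>{1..A}. measure_pmf.prob (output_pmf (c m) l) {f. \<gamma> * N \<le> score (c m') l' f})"

text \<open>Stopping happens at the fixed time T. Off the events summed in \<open>err\<close> the
  sent message is the only one that hits, so it is decoded; a hit of its codeword in a wrong window
  does no harm.\<close>

lemma P_err_ml_le_err:
  assumes "m < M" "l \<in> {1..A}"
  shows "P_err_ml Q star (\<lambda>m. map (c m) [0..<N]) (\<lambda>w. length w = T) (dec M c) m l \<le> err M c m l"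
proof -
  let ?stop = "\<lambda>w :: 'y list. length w = T" and ?cw = "map (c m) [0..<N]"
  have stops: "stops_at ?stop n = (if n = T then {w. length w = T} else {})" for n
    by (auto simp: stops_at_def)

  have "(\<Sum>n. P_stop_dec Q star ?cw l ?stop (dec M c) m n) = P_stop_dec Q star ?cw l ?stop (dec M c) m T"
    by (rule trans[OF suminf_finite[of "{T}"]]) (auto simp: P_stop_dec_def stops)
  also have "\<dots> = measure_pmf.prob (output_pmf (c m) l) {f. map f [0..<T] \<in> {w. length w = T \<and> dec M c w = m}}"
    unfolding P_stop_dec_def output_pmf_def sent_def by (subst sum_prefix_prob[of T T]) (auto simp: stops)
  finally have "P_err_ml Q star (\<lambda>m. map (c m) [0..<N]) ?stop (dec M c) m l =
      1 - measure_pmf.prob (output_pmf (c m) l) {f. dec M c (map f [0..<T]) = m}"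
    by (simp add: P_err_ml_def)
  also have "\<dots> = measure_pmf.prob (output_pmf (c m) l) {f. dec M c (map f [0..<T]) \<noteq> m}"
    using measure_pmf.prob_compl[of "{f. dec M c (map f [0..<T]) = m}" "output_pmf (c m) l"]
    by (simp add: Compl_eq_Diff_UNIV[symmetric] Collect_neg_eq)
  also have "\<dots> \<le> measure_pmf.prob (output_pmf (c m) l) ({f. score (c m) l f < \<gamma> * N} \<union>
      (\<Union>m'\<in>{..<M} - {m}. \<Union>l'\<in>{1..A}. {f. \<gamma> * N \<le> score (c m') l' f}))"
  proof (rule measure_pmf.finite_measure_mono, rule subsetI, rule ccontr)
    fix f assume f: "f \<in> {f. dec M c (map f [0..<T]) \<noteq> m}"
      and "f \<notin> {f. score (c m) l f < \<gamma> * N} \<union>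
        (\<Union>m'\<in>{..<M} - {m}. \<Union>l'\<in>{1..A}. {f. \<gamma> * N \<le> score (c m') l' f})"
    then have own: "\<not> score (c m) l f < \<gamma> * N"
      and other: "\<And>m' l'. m' \<in> {..<M} - {m} \<Longrightarrow> l' \<in> {1..A} \<Longrightarrow> \<not> \<gamma> * N \<le> score (c m') l' f"
      by blast+
    have "hit (c m) (map f [0..<T])"
      unfolding hit_map using assms own by (intro bexI[of _ l]) auto
    moreover have "\<not> hit (c m') (map f [0..<T])" if "m' < M" "m' \<noteq> m" for m'
      unfolding hit_map using that other by auto
    ultimately have "dec M c (map f [0..<T]) = m"
      using assms by (intro dec_eq)
    then show False
      using f by simp
  qed simp
  also have "\<dots> \<le> err M c m l"
    unfolding err_def
    by (intro order_trans[OF measure_Un_le] add_left_mono order_trans[OF measure_UNION_le] sum_mono) auto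
  finally show ?thesis .
qed

text \<open>The sent word is missed; or, per wrong message, a false alarm occurs in one of at most
  2N windows overlapping the true block or A windows of noise.\<close>

definition bound :: "nat \<Rightarrow> real" where
  "bound M = exp (- (t * N * (a2 - \<gamma>))) +
    M * (2 * N * exp (- (t * N * (\<gamma> - a1))) + A * exp (- (\<gamma> * N)))"

definition code_pmf :: "nat \<Rightarrow> (nat \<Rightarrow> nat \<Rightarrow> 'x) pmf" where
  "code_pmf M = Pi_pmf {..<M} undefined (\<lambda>_. word_pmf)"

lemma integrable_code_pmf [simp]: "integrable (code_pmf M) (f :: _ \<Rightarrow> real)"
  unfolding code_pmf_def by (intro integrable_measure_pmf_finite, subst set_Pi_pmf) auto

lemma expect_err:
  assumes m: "m < M" and l: "l \<in> {1..A}"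
  shows "expect (code_pmf M) (\<lambda>c. err M c m l) \<le> bound M"
proof -
  let ?fa = "\<lambda>u l u' l'. measure_pmf.prob (output_pmf u l) {f. \<gamma> * N \<le> score u' l' f}"
  have own': "expect (code_pmf M) (\<lambda>c. measure_pmf.prob (output_pmf (c m) l) {f. score (c m) l f < \<gamma> * N}) \<le>
      exp (- (t * N * (a2 - \<gamma>)))"
    using own_failure[of l] l m
    unfolding code_pmf_def
    by (simp add: expect_Pi_pmf_component[where \<phi> = "\<lambda>u. measure_pmf.prob (output_pmf u l) {f. score u l f < \<gamma> * N}"])
  \<comment> \<open>Both bounds are added instead of split by cases, so the sum over l' only needs
    the number of start times near l.\<close>
  have fa: "expect (code_pmf M) (\<lambda>c. ?fa (c m) l (c m') l') \<le>
      (if l' \<in> {l - N..<l + N} then exp (- (t * N * (\<gamma> - a1))) else 0) + exp (- (\<gamma> * N))"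
    if m': "m' \<in> {..<M} - {m}" and l': "l' \<in> {1..A}" for m' l'
  proof -
    have eq: "expect (code_pmf M) (\<lambda>c. ?fa (c m) l (c m') l') =
        expect word_pmf (\<lambda>u. expect word_pmf (\<lambda>u'. ?fa u l u' l'))"
      unfolding code_pmf_def using m m'
      by (intro expect_Pi_pmf_two_components[where \<psi> = "\<lambda>u u'. ?fa u l u' l'"]) auto
    show ?thesis
    proof (cases "block N l \<inter> block N l' = {}")
      case True
      have "expect word_pmf (\<lambda>u. expect word_pmf (\<lambda>u'. ?fa u l u' l')) \<le>
          expect word_pmf (\<lambda>u. expect word_pmf (\<lambda>u'. exp (- (\<gamma> * N))))"
        by (intro expect_mono false_alarm_noise True) auto
      then show ?thesis
        unfolding eq by (simp add: add_increasing)
    next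
      case False
      show ?thesis
        unfolding eq using block_overlap[OF False] false_alarm_overlap[of l l'] l l'
        by (simp add: add_increasing2)
    qed
  qed
  have "expect (code_pmf M) (\<lambda>c. err M c m l) =
      expect (code_pmf M) (\<lambda>c. measure_pmf.prob (output_pmf (c m) l) {f. score (c m) l f < \<gamma> * N}) +
      (\<Sum>m'\<in>{..<M} - {m}. \<Sum>l'\<in>{1..A}. expect (code_pmf M) (\<lambda>c. ?fa (c m) l (c m') l'))"
    by (simp add: err_def)
  also have "\<dots> \<le> exp (- (t * N * (a2 - \<gamma>))) + (\<Sum>m'\<in>{..<M} - {m}. \<Sum>l'\<in>{1..A}.
      (if l' \<in> {l - N..<l + N} then exp (- (t * N * (\<gamma> - a1))) else 0) + exp (- (\<gamma> * N)))"
    by (intro add_mono own' sum_mono fa)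
  also have "\<dots> \<le> exp (- (t * N * (a2 - \<gamma>))) + (\<Sum>m'\<in>{..<M} - {m}.
      2 * N * exp (- (t * N * (\<gamma> - a1))) + A * exp (- (\<gamma> * N)))"
  proof (intro add_left_mono sum_mono)
    have "card ({1..A} \<inter> {l - N..<l + N}) \<le> card {l - N..<l + N}"
      by (rule card_mono) auto
    then have "real (card ({1..A} \<inter> {l - N..<l + N})) \<le> 2 * N"
      by simp
    moreover have "{l'. l - N \<le> l' \<and> l' < l + N} = {l - N..<l + N}"
      by auto
    ultimately show "(\<Sum>l'\<in>{1..A}. (if l' \<in> {l - N..<l + N} then exp (- (t * N * (\<gamma> - a1))) else 0)
        + exp (- (\<gamma> * N))) \<le> 2 * N * exp (- (t * N * (\<gamma> - a1))) + A * exp (- (\<gamma> * N))"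
      by (simp add: sum.distrib sum.If_cases)
  qed
  also have "\<dots> \<le> bound M"
    unfolding bound_def sum_constant
    using card_Diff1_le[of "{..<M}" m] by (intro add_left_mono mult_right_mono) auto
  finally show ?thesis .
qed

text \<open>The ensemble mean of the error averaged over messages and start times is at most
  \<open>bound M\<close>, so some code does no worse.\<close>

lemma ex_good_code:
  assumes M: "M \<ge> 2"
  shows "\<exists>c stop dec. valid_code N M c dec \<and> P_error Q star A M c stop dec \<le> bound M"
proof -
  define X where "X c = (\<Sum>m<M. \<Sum>l\<in>{1..A}. err M c m l) / (real A * real M)" for c
  have "expect (code_pmf M) X = (\<Sum>m<M. \<Sum>l\<in>{1..A}. expect (code_pmf M) (\<lambda>c. err M c m l)) / (real A * real M)"
    by (simp add: X_def[abs_def])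
  also have "\<dots> \<le> (\<Sum>m<M. \<Sum>l\<in>{1..A}. bound M) / (real A * real M)"
    by (intro divide_right_mono sum_mono expect_err) auto
  also have "\<dots> = bound M"
    using A M by simp
  finally have "\<not> bound M < expect (code_pmf M) X"
    by simp
  then obtain c where c: "X c \<le> bound M"
    using measure_pmf.expectation_greater[of "code_pmf M" X "bound M"] by (force simp: not_less)
  have "P_error Q star A M (\<lambda>m. map (c m) [0..<N]) (\<lambda>w. length w = T) (dec M c) \<le> X c"
    unfolding P_error_def X_def by (intro divide_right_mono sum_mono P_err_ml_le_err) auto
  moreover have "valid_code N M (\<lambda>m. map (c m) [0..<N]) (dec M c)"
    using M dec_less[of M c] by (auto simp: valid_code_def)
  ultimately show ?thesis
    using c order_trans by blast
qed

end

section \<open>Achievability\<close>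

text \<open>The score is the log-likelihood ratio of (1 - s) P + s q against q: its exponential has
  mean at most 1 under q, and its P-mean tends to the divergence as s -> 0. Mixing keeps the
  argument of the logarithm positive. If P charges a q-null output, the score there is free under q
  and can be raised at will.\<close>

lemma ex_score:
  fixes P q :: "'y::finite pmf"
  assumes "ereal d0 < KL_div P q"
  shows "\<exists>g. expect q (\<lambda>y. exp (g y)) \<le> 1 \<and> d0 < expect P g"
proof -
  let ?g = "\<lambda>s y. ln ((1 - s) * (pmf P y / pmf q y) + s)"
  have exp_g: "exp (?g s y) = (1 - s) * (pmf P y / pmf q y) + s" if "0 < s" "s < 1" for s y
    using that by (intro exp_ln add_nonneg_pos mult_nonneg_nonneg) auto
  have mass: "pmf q y * exp (?g s y) \<le> (1 - s) * pmf P y + s * pmf q y" if "0 < s" "s < 1" for s y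
    unfolding exp_g[OF that] using that by (simp add: distrib_left)
  have total: "(\<Sum>y\<in>UNIV. (1 - s) * pmf P y + s * pmf q y) = 1" for s
    by (simp add: sum.distrib sum_distrib_left[symmetric] sum_pmf_eq_1)
  show ?thesis
  proof (cases "\<forall>y. pmf P y > 0 \<longrightarrow> pmf q y > 0")
    case True
    have "((\<lambda>s. expect P (?g s)) \<longlongrightarrow> (\<Sum>y\<in>UNIV. pmf P y * ln (pmf P y / pmf q y))) (at_right 0)"
      unfolding expect_finite_type
    proof (rule tendsto_sum)
      fix y
      show "((\<lambda>s. pmf P y * ?g s y) \<longlongrightarrow> pmf P y * ln (pmf P y / pmf q y)) (at_right 0)"
      proof (cases "pmf P y = 0")
        case False
        then have "pmf P y / pmf q y \<noteq> 0"
          using True pmf_pos[of P y] by (metis divide_eq_0_iff less_irrefl)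
        then have "((\<lambda>s. pmf P y * ?g s y) \<longlongrightarrow> pmf P y * ln ((1 - 0) * (pmf P y / pmf q y) + 0)) (at_right 0)"
          by (intro tendsto_intros) auto
        then show ?thesis
          by simp
      qed simp
    qed
    moreover have "(\<Sum>y\<in>UNIV. pmf P y * ln (pmf P y / pmf q y)) > d0"
      using assms KL_div_finite[of P q] True by (simp add: expect_finite_type)
    ultimately have "\<forall>\<^sub>F s in at_right 0. d0 < expect P (?g s)"
      by (rule order_tendstoD)
    moreover have "\<forall>\<^sub>F s in at_right 0. s \<in> {0<..<1::real}"
      by (rule eventually_at_rightI[of 0 1]) auto
    ultimately have "\<forall>\<^sub>F s in at_right 0. d0 < expect P (?g s) \<and> s \<in> {0<..<1}"
      by (rule eventually_conj)
    then have "\<exists>s. d0 < expect P (?g s) \<and> s \<in> {0<..<1}"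
      by (rule eventually_happens'[OF trivial_limit_at_right_real])
    then obtain s where s: "0 < s" "s < 1" "d0 < expect P (?g s)"
      by auto
    moreover have "expect q (\<lambda>y. exp (?g s y)) \<le> 1"
    proof -
      have "expect q (\<lambda>y. exp (?g s y)) \<le> (\<Sum>y\<in>UNIV. (1 - s) * pmf P y + s * pmf q y)"
        unfolding expect_finite_type using s by (intro sum_mono mass) auto
      then show ?thesis
        by (simp only: total)
    qed
    ultimately show ?thesis
      by (intro exI[of _ "?g s"] conjI)
  next
    case False
    then obtain y0 where y0: "pmf P y0 > 0" "pmf q y0 = 0"
      by (metis less_le pmf_nonneg)
    define c where "c = (\<Sum>y\<in>{y. pmf q y = 0}. pmf P y)"
    define k where "k = (\<Sum>y\<in>- {y. pmf q y = 0}. pmf P y * ?g (1/2) y)"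
    \<comment> \<open>The constant on the q-null outputs makes \<open>expect P h\<close> equal to d0
      + 1.\<close>
    define h where "h y = (if pmf q y = 0 then (d0 + 1 - k) / c else ?g (1/2) y)" for y
    have "c > 0"
      unfolding c_def using y0 by (intro sum_pos2[of _ y0]) auto
    have "expect P h = c * ((d0 + 1 - k) / c) + k"
    proof -
      have "expect P h = (\<Sum>y\<in>UNIV. if pmf q y = 0 then pmf P y * ((d0 + 1 - k) / c) else pmf P y * ?g (1/2) y)"
        unfolding expect_finite_type h_def by (intro sum.cong) auto
      also have "\<dots> = (\<Sum>y\<in>{y. pmf q y = 0}. pmf P y * ((d0 + 1 - k) / c)) + k"
        by (subst sum.If_cases) (simp_all only: k_def finite Int_UNIV_left)
      finally show ?thesis
        by (simp only: c_def sum_distrib_right)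
    qed
    then have "d0 < expect P h"
      using \<open>c > 0\<close> by simp
    moreover have "expect q (\<lambda>y. exp (h y)) \<le> 1"
    proof -
      have "pmf q y * exp (h y) \<le> (1 - 1/2) * pmf P y + 1/2 * pmf q y" for y
        using mass[of "1/2" y] by (cases "pmf q y = 0") (auto simp: h_def)
      then have "expect q (\<lambda>y. exp (h y)) \<le> (\<Sum>y\<in>UNIV. (1 - 1/2) * pmf P y + 1/2 * pmf q y)"
        unfolding expect_finite_type by (intro sum_mono)
      then show ?thesis
        by (simp only: total)
    qed
    ultimately show ?thesis
      by blast
  qed
qed

lemma expect_bind:
  fixes p :: "'a::finite pmf" and K :: "'a \<Rightarrow> 'b::finite pmf"
  shows "expect (p \<bind> K) h = expect p (\<lambda>x. expect (K x) h)"
  by (subst pmf_expectation_bind[of UNIV]) (auto simp: expect_finite_type)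

text \<open>The three averages are means under joint laws of a scoring letter and an output, so
  \<open>eventually_mgf_le\<close> applies to each and one t serves all.\<close>

lemma ex_random_code:
  fixes Q :: "'x::finite \<Rightarrow> 'y::finite pmf"
  assumes noise: "\<And>x. expect (Q star) (\<lambda>y. exp (g x y)) \<le> 1" and g_star: "\<And>y. g star y = 0"
    and cross: "expect p (\<lambda>x'. expect (Q star) (g x')) < a1"
      "expect p (\<lambda>x. expect p (\<lambda>x'. expect (Q x) (g x'))) < a1"
    and own: "expect p (\<lambda>x. expect (Q x) (g x)) > a2"
  shows "\<exists>t>0. \<forall>A\<ge>1. \<forall>N. random_code Q star p g t a1 a2 A N (A + N)"
proof -
  \<comment> \<open>The scoring letter is paired with noise, with the output of an independent
    letter, and with its own output.\<close>
  let ?p1 = "p \<bind> (\<lambda>x'. map_pmf (Pair x') (Q star))"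
    and ?p2 = "p \<bind> (\<lambda>x. p \<bind> (\<lambda>x'. map_pmf (Pair x') (Q x)))"
    and ?p3 = "p \<bind> (\<lambda>x. map_pmf (Pair x) (Q x))"
  have "\<forall>\<^sub>F t in at_right 0. 0 < t \<and>
      expect ?p1 (\<lambda>z. exp (t * (case z of (x, y) \<Rightarrow> g x y))) \<le> exp (t * a1) \<and>
      expect ?p2 (\<lambda>z. exp (t * (case z of (x, y) \<Rightarrow> g x y))) \<le> exp (t * a1) \<and>
      expect ?p3 (\<lambda>z. exp (t * (case z of (x, y) \<Rightarrow> - g x y))) \<le> exp (t * (- a2))"
    using cross own
    by (intro eventually_conj eventually_mgf_le eventually_at_right_less) (simp_all add: expect_bind)
  then obtain t where t: "0 < t"
      "expect ?p1 (\<lambda>z. exp (t * (case z of (x, y) \<Rightarrow> g x y))) \<le> exp (t * a1)"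
      "expect ?p2 (\<lambda>z. exp (t * (case z of (x, y) \<Rightarrow> g x y))) \<le> exp (t * a1)"
      "expect ?p3 (\<lambda>z. exp (t * (case z of (x, y) \<Rightarrow> - g x y))) \<le> exp (t * (- a2))"
    using eventually_happens'[OF trivial_limit_at_right_real] by blast
  have "random_code Q star p g t a1 a2 A N (A + N)" if "A \<ge> 1" for A N
    by unfold_locales (use t that noise g_star in \<open>simp_all add: expect_bind\<close>)
  then show ?thesis
    using t(1) by blast
qed

section \<open>Sizes of the asynchronism level and of the message set\<close>

lemma async_level_bounds:
  "1 \<le> async_level \<alpha> N" "async_level \<alpha> N \<le> 2 * exp (max \<alpha> 0 * N)"
proof -
  have "0 < \<lceil>exp (\<alpha> * N)\<rceil>"
    by (simp add: less_ceiling_iff)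
  then show "1 \<le> async_level \<alpha> N"
    unfolding async_level_def by linarith
  have "async_level \<alpha> N \<le> exp (\<alpha> * N) + 1"
    using \<open>0 < \<lceil>exp (\<alpha> * N)\<rceil>\<close> by (simp add: async_level_def)
  also have "\<dots> \<le> exp (max \<alpha> 0 * N) + exp (max \<alpha> 0 * N)"
    by (intro add_mono) (auto intro: mult_right_mono)
  finally show "async_level \<alpha> N \<le> 2 * exp (max \<alpha> 0 * N)"
    by simp
qed

text \<open>The added 1 guarantees two messages for every N.\<close>

definition message_count :: "real \<Rightarrow> nat \<Rightarrow> nat" where
  "message_count L N = nat \<lceil>exp (L * N)\<rceil> + 1"

lemma message_count_bounds:
  assumes "L \<ge> 0"
  shows "2 \<le> message_count L N" "exp (L * N) \<le> message_count L N" "message_count L N \<le> 3 * exp (L * N)"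
proof -
  have "0 < \<lceil>exp (L * N)\<rceil>"
    by (simp add: less_ceiling_iff)
  then show "2 \<le> message_count L N"
    unfolding message_count_def by linarith
  show "exp (L * N) \<le> message_count L N"
    unfolding message_count_def by linarith
  have "1 \<le> exp (L * N)"
    using assms by simp
  moreover have "message_count L N \<le> exp (L * N) + 2"
    using \<open>0 < \<lceil>exp (L * N)\<rceil>\<close> unfolding message_count_def by linarith
  ultimately show "message_count L N \<le> 3 * exp (L * N)"
    by linarith
qed

lemma message_count_rate:
  assumes "L \<ge> 0"
  shows "(\<lambda>N. ln (message_count L N) / N) \<longlonglongrightarrow> L"
proof (rule tendsto_sandwich)
  show "\<forall>\<^sub>F N in sequentially. L \<le> ln (message_count L N) / N"
    using eventually_gt_at_top[of 0]
  proof eventually_elim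
    case (elim N)
    have "L * N \<le> ln (message_count L N)"
      using message_count_bounds[OF assms, of N] by (subst ln_ge_iff) auto
    then show ?case
      using elim by (simp add: pos_le_divide_eq)
  qed
  show "\<forall>\<^sub>F N in sequentially. ln (message_count L N) / N \<le> L + ln 3 / N"
    using eventually_gt_at_top[of 0]
  proof eventually_elim
    case (elim N)
    have "ln (message_count L N) \<le> ln (3 * exp (L * N))"
      using message_count_bounds[OF assms, of N] by (intro ln_mono) auto
    then show ?case
      using elim by (simp add: ln_mult field_simps)
  qed
  show "(\<lambda>N. L + ln 3 / real N) \<longlonglongrightarrow> L"
    by real_asymp
qed simp

text \<open>Codeword letters are \<open>xs\<close> with probability \<mu> and \<open>star\<close>
  otherwise. Per letter, the sent codeword has mean score \<mu> d and a wrong one at most \<mu>^2 d.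
  A threshold between the two that also exceeds \<beta> beats the A noise windows and exponentially
  many wrong words.\<close>

lemma ex_strategy:
  fixes Q :: "'x::finite \<Rightarrow> 'y::finite pmf"
  assumes \<alpha>: "ereal (max \<alpha> 0) < KL_div (Q xs) (Q star)"
  shows "\<exists>M c stop dec L. (\<forall>N. valid_code N (M N) (c N) (dec N)) \<and>
     (\<lambda>N. P_error Q star (async_level \<alpha> N) (M N) (c N) (stop N) (dec N)) \<longlonglongrightarrow> 0 \<and>
     (\<lambda>N. ln (real (M N)) / real N) \<longlonglongrightarrow> L \<and> L > 0"
proof -
  define \<beta> where "\<beta> = max \<alpha> 0"
  obtain g0 where g0: "expect (Q star) (\<lambda>y. exp (g0 y)) \<le> 1" "\<beta> < expect (Q xs) g0"
    using ex_score[OF \<alpha>] by (auto simp: \<beta>_def)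
  define d where "d = expect (Q xs) g0"
  define e where "e = expect (Q star) g0"
  \<comment> \<open>By 1 + x <= exp x, the score has nonpositive mean under noise.\<close>
  have "e \<le> expect (Q star) (\<lambda>y. exp (g0 y) - 1)"
    unfolding e_def by (rule expect_mono) (use exp_ge_add_one_self in \<open>auto simp: le_diff_eq add.commute\<close>)
  then have e: "e \<le> 0"
    using g0 by simp
  have \<beta>: "0 \<le> \<beta>" and d: "\<beta> < d"
    using g0 by (auto simp: \<beta>_def d_def)
  have neq: "xs \<noteq> star"
    using e d \<beta> unfolding d_def e_def by auto
  \<comment> \<open>\<mu>^2 is the midpoint of \<beta>/d and 1, so that \<beta> < \<mu>^2 d < \<mu>
    d.\<close>
  define \<mu> where "\<mu> = sqrt ((1 + \<beta> / d) / 2)"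
  have \<mu>2: "\<mu>\<^sup>2 = (1 + \<beta> / d) / 2"
    using \<beta> d by (simp add: \<mu>_def)
  have ratio: "0 \<le> \<beta> / d" "\<beta> / d < 1"
    using \<beta> d by simp_all
  then have "0 < (1 + \<beta> / d) / 2" "(1 + \<beta> / d) / 2 < 1"
    by simp_all
  then have \<mu>: "0 < \<mu>" "\<mu> < 1"
    unfolding \<mu>_def by (simp_all only: real_sqrt_gt_0_iff real_sqrt_lt_1_iff)
  have \<mu>d: "\<beta> < \<mu>\<^sup>2 * d" "\<mu>\<^sup>2 * d < \<mu> * d"
  proof -
    show "\<beta> < \<mu>\<^sup>2 * d"
      unfolding \<mu>2 using \<beta> d by (simp add: field_simps)
    show "\<mu>\<^sup>2 * d < \<mu> * d"
      using \<mu> \<beta> d by (simp add: power2_eq_square)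
  qed
  \<comment> \<open>A quarter of the gap: \<gamma> becomes the midpoint, and \<gamma> - h and
    \<gamma> + h stay strictly between the two mean scores.\<close>
  define h where "h = (\<mu> * d - \<mu>\<^sup>2 * d) / 4"
  have h: "h > 0"
    using \<mu>d by (simp add: h_def)
  define \<gamma> where "\<gamma> = \<mu>\<^sup>2 * d + 2 * h"
  define p where "p = map_pmf (\<lambda>b. if b then xs else star) (bernoulli_pmf \<mu>)"
  define g where "g x y = (if x = star then 0 else g0 y)" for x y
  have expect_p: "expect p \<phi> = \<mu> * \<phi> xs + (1 - \<mu>) * \<phi> star" for \<phi>
    using \<mu> unfolding p_def integral_map_pmf by (simp add: expect_finite_type UNIV_bool)
  have "\<exists>t>0. \<forall>A\<ge>1. \<forall>N. random_code Q star p g t (\<gamma> - h) (\<gamma> + h) A N (A + N)"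
  proof (rule ex_random_code)
    show "expect (Q star) (\<lambda>y. exp (g x y)) \<le> 1" for x
      using g0 by (cases "x = star") (simp_all add: g_def)
    have "\<mu> * e \<le> 0" "\<mu> * ((1 - \<mu>) * e) \<le> 0"
      using \<mu> e by (auto intro!: mult_nonneg_nonpos)
    moreover have "\<gamma> - h = \<mu>\<^sup>2 * d + h" "\<gamma> + h = \<mu> * d - h"
      by (simp_all add: \<gamma>_def h_def field_simps)
    moreover have "expect p (\<lambda>x'. expect (Q star) (g x')) = \<mu> * e"
      "expect p (\<lambda>x. expect p (\<lambda>x'. expect (Q x) (g x'))) = \<mu>\<^sup>2 * d + \<mu> * ((1 - \<mu>) * e)"
      "expect p (\<lambda>x. expect (Q x) (g x)) = \<mu> * d"
      using neq unfolding expect_p g_def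
      by (simp_all add: d_def[symmetric] e_def[symmetric] algebra_simps power2_eq_square)
    ultimately show "expect p (\<lambda>x'. expect (Q star) (g x')) < \<gamma> - h"
      and "expect p (\<lambda>x. expect p (\<lambda>x'. expect (Q x) (g x'))) < \<gamma> - h"
      and "\<gamma> + h < expect p (\<lambda>x. expect (Q x) (g x))"
      using \<mu>d h \<beta> by linarith+
  qed (simp add: g_def)
  then obtain t where t: "t > 0"
    and code: "\<And>A N. A \<ge> 1 \<Longrightarrow> random_code Q star p g t (\<gamma> - h) (\<gamma> + h) A N (A + N)"
    by blast
  \<comment> \<open>Half of the smaller decay exponent: the terms multiplied by M decay like
    exp(-2LN), and about exp(LN) messages leave exp(-LN), up to a factor linear in N.\<close>
  define L where "L = min (t * h) (\<gamma> - \<beta>) / 2"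
  have L: "L > 0" "2 * L \<le> t * h" "2 * L \<le> \<gamma> - \<beta>"
    using t h \<mu>d by (auto simp: L_def \<gamma>_def)
  define B where "B N = exp (- (2 * L * N)) + 6 * (real N + 1) * exp (- (L * N))" for N :: nat
  define M where "M = message_count L"
  have "\<exists>c stop dec. valid_code N (M N) c dec \<and> P_error Q star (async_level \<alpha> N) (M N) c stop dec \<le> B N" for N
  proof -
    let ?A = "async_level \<alpha> N"
    interpret random_code Q star p g t "\<gamma> - h" "\<gamma> + h" \<gamma> ?A N "?A + N"
      by (rule code) (rule async_level_bounds)
    have th: "exp (- (t * N * h)) \<le> exp (- (2 * L * N))"
      using mult_right_mono[OF L(2), of N] by (simp add: algebra_simps)
    have "?A * exp (- (\<gamma> * N)) \<le> 2 * exp (\<beta> * N) * exp (- (\<gamma> * N))"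
      unfolding \<beta>_def by (intro mult_right_mono async_level_bounds) auto
    also have "\<dots> = 2 * exp (- ((\<gamma> - \<beta>) * N))"
      by (simp flip: exp_add add: algebra_simps)
    also have "\<dots> \<le> 2 * exp (- (2 * L * N))"
      using mult_right_mono[OF L(3), of N] by simp
    finally have "2 * N * exp (- (t * N * h)) + ?A * exp (- (\<gamma> * N)) \<le>
        2 * N * exp (- (2 * L * N)) + 2 * exp (- (2 * L * N))"
      using th by (intro add_mono mult_left_mono) auto
    then have "M N * (2 * N * exp (- (t * N * h)) + ?A * exp (- (\<gamma> * N))) \<le>
        3 * exp (L * N) * (2 * N * exp (- (2 * L * N)) + 2 * exp (- (2 * L * N)))"
      unfolding M_def using L by (intro mult_mono message_count_bounds) auto
    also have "\<dots> = 6 * (real N + 1) * (exp (L * N) * exp (- (2 * L * N)))"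
      by (simp add: algebra_simps)
    also have "exp (L * N) * exp (- (2 * L * N)) = exp (- (L * N))"
      by (simp flip: exp_add)
    finally have "M N * (2 * N * exp (- (t * N * h)) + ?A * exp (- (\<gamma> * N))) \<le>
        6 * (real N + 1) * exp (- (L * N))" .
    from add_mono[OF th this] have "bound (M N) \<le> B N"
      by (simp only: bound_def B_def add_diff_cancel_left' diff_diff_eq2)
    moreover have "2 \<le> M N"
      unfolding M_def using L by (intro message_count_bounds) simp
    ultimately show ?thesis
      using ex_good_code[of "M N"] order_trans by blast
  qed
  then obtain c stop dec where valid: "\<And>N. valid_code N (M N) (c N) (dec N)"
    and err: "\<And>N. P_error Q star (async_level \<alpha> N) (M N) (c N) (stop N) (dec N) \<le> B N"
    by metis
  have B: "B \<longlonglongrightarrow> 0"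
    unfolding B_def using L(1) by real_asymp
  have "(\<lambda>N. P_error Q star (async_level \<alpha> N) (M N) (c N) (stop N) (dec N)) \<longlonglongrightarrow> 0"
    by (rule tendsto_sandwich[OF _ _ tendsto_const B]) (auto simp: P_error_nonneg err)
  moreover have "(\<lambda>N. ln (real (M N)) / real N) \<longlonglongrightarrow> L"
    unfolding M_def using L by (intro message_count_rate) simp
  ultimately show ?thesis
    using valid L(1) by blast
qed

text \<open>\<open>code_rate\<close> is nonnegative for M >= 2, even for infinite delay, so at R = 0
  the rate condition holds for any valid code.\<close>

lemma achievable_exponent_0:
  fixes Q :: "'x::finite \<Rightarrow> 'y::finite pmf"
  assumes "\<And>\<epsilon>. \<epsilon> > 0 \<Longrightarrow> \<exists>M c stop dec. (\<forall>N. valid_code N (M N) (c N) (dec N)) \<and>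
     (\<lambda>N. P_error Q star (async_level (\<alpha> - \<epsilon>) N) (M N) (c N) (stop N) (dec N)) \<longlonglongrightarrow> 0"
  shows "achievable_exponent Q star 0 \<alpha>"
  unfolding achievable_exponent_def
proof (intro allI impI)
  fix \<epsilon> :: real assume \<epsilon>: "\<epsilon> > 0"
  let ?A = "async_level (\<alpha> - \<epsilon>)"
  obtain M c stop dec where valid: "\<And>N. valid_code N (M N) (c N) (dec N)"
    and lim: "(\<lambda>N. P_error Q star (?A N) (M N) (c N) (stop N) (dec N)) \<longlonglongrightarrow> 0"
    using assms[OF \<epsilon>] by blast
  obtain N0 where err: "\<And>N. N \<ge> N0 \<Longrightarrow> P_error Q star (?A N) (M N) (c N) (stop N) (dec N) \<le> \<epsilon>"
    using order_tendstoD(2)[OF lim \<epsilon>] unfolding eventually_sequentially by (metis less_imp_le)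
  have rate: "code_rate m E \<ge> ereal (0 - \<epsilon>)" if "m \<ge> 2" for m E
  proof -
    have "ln (real m) / enn2real E \<ge> 0"
      using that by (intro divide_nonneg_nonneg) auto
    then have "code_rate m E \<ge> 0"
      by (simp add: code_rate_def)
    then show ?thesis
      by (rule order_trans[rotated]) (use \<epsilon> in simp)
  qed
  show "\<exists>N0. \<forall>N\<ge>N0. \<exists>M (c :: nat \<Rightarrow> 'x list) (stop :: 'y list \<Rightarrow> bool) dec.
      valid_code N M c dec \<and> code_rate M (avg_delay Q star (?A N) M c stop) \<ge> ereal (0 - \<epsilon>) \<and>
      P_error Q star (?A N) M c stop dec \<le> \<epsilon>"
  proof (intro exI allI impI conjI)
    fix N assume "N \<ge> N0"
    show "valid_code N (M N) (c N) (dec N)"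
      by (rule valid)
    show "code_rate (M N) (avg_delay Q star (?A N) (M N) (c N) (stop N)) \<ge> ereal (0 - \<epsilon>)"
      using valid[of N] by (intro rate) (simp add: valid_code_def)
    show "P_error Q star (?A N) (M N) (c N) (stop N) (dec N) \<le> \<epsilon>"
      by (rule err) fact
  qed
qed

theorem theorem1:
  fixes Q :: "'x::finite \<Rightarrow> 'y::finite pmf" and star :: 'x
  assumes outputs_reachable: "\<forall>y. \<exists>x. pmf (Q x) y > 0"
    and capacity_pos: "capacity Q > 0"
  shows "sync_threshold Q star = (MAX x\<in>UNIV. KL_div (Q x) (Q star)) \<and>
         (\<forall>\<alpha>::real. ereal \<alpha> < sync_threshold Q star \<longrightarrow>
          (\<exists>(M :: nat \<Rightarrow> nat) (c :: nat \<Rightarrow> nat \<Rightarrow> 'x list) (stop :: nat \<Rightarrow> 'y list \<Rightarrow> bool)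
             (dec :: nat \<Rightarrow> 'y list \<Rightarrow> nat) (L :: real).
             (\<forall>N. valid_code N (M N) (c N) (dec N)) \<and>
             (\<lambda>N. P_error Q star (async_level \<alpha> N) (M N) (c N) (stop N) (dec N)) \<longlonglongrightarrow> 0 \<and>
             (\<lambda>N. ln (real (M N)) / real N) \<longlonglongrightarrow> L \<and> L > 0))"
proof -
  define D where "D = (MAX x\<in>UNIV. KL_div (Q x) (Q star))"
  \<comment> \<open>Positive capacity enters here: it makes D > 0, so that \<alpha> < D gives
    \<open>max \<alpha> 0 < D\<close>, as \<open>ex_strategy\<close> requires.\<close>
  have "\<exists>x. Q x \<noteq> Q star"
  proof (rule ccontr)
    assume "\<nexists>x. Q x \<noteq> Q star"
    then have "Q = (\<lambda>_. Q star)"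
      by auto
    then have "capacity Q = 0"
      by (metis capacity_const)
    then show False
      using capacity_pos by simp
  qed
  then have "D > 0"
    unfolding D_def by (subst Max_gr_iff) (auto intro: KL_div_pos)
  obtain xs where xs: "D = KL_div (Q xs) (Q star)"
  proof -
    have "D \<in> range (\<lambda>x. KL_div (Q x) (Q star))"
      unfolding D_def by (intro Max_in) auto
    then show ?thesis
      using that by blast
  qed
  have strategy: "\<exists>M c stop dec L. (\<forall>N. valid_code N (M N) (c N) (dec N)) \<and>
       (\<lambda>N. P_error Q star (async_level \<alpha> N) (M N) (c N) (stop N) (dec N)) \<longlonglongrightarrow> 0 \<and>
       (\<lambda>N. ln (real (M N)) / real N) \<longlonglongrightarrow> L \<and> L > 0" if "ereal \<alpha> < D" for \<alpha>
    using that \<open>D > 0\<close> unfolding xs by (intro ex_strategy[where xs = xs]) (simp add: max_def zero_ereal_def)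
  have ach: "achievable_exponent Q star 0 \<alpha>" if "ereal \<alpha> < D" for \<alpha>
  proof (rule achievable_exponent_0)
    fix \<epsilon> :: real assume "\<epsilon> > 0"
    then have "ereal (\<alpha> - \<epsilon>) < D"
      using that by (intro less_trans[OF _ that]) simp
    from strategy[OF this] show "\<exists>M c stop dec. (\<forall>N. valid_code N (M N) (c N) (dec N)) \<and>
        (\<lambda>N. P_error Q star (async_level (\<alpha> - \<epsilon>) N) (M N) (c N) (stop N) (dec N)) \<longlonglongrightarrow> 0"
      by blast
  qed
  have "sync_threshold Q star = D"
    unfolding sync_threshold_def async_exponent_def
  proof (rule Sup_eqI)
    fix a assume "a \<in> ereal ` {\<alpha>. achievable_exponent Q star 0 \<alpha>}"
    then show "a \<le> D"
      using achievable_exponent_le[OF outputs_reachable] by (auto simp: D_def)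
  next
    fix b assume b: "\<And>a. a \<in> ereal ` {\<alpha>. achievable_exponent Q star 0 \<alpha>} \<Longrightarrow> a \<le> b"
    show "D \<le> b"
    proof (rule ccontr)
      assume "\<not> D \<le> b"
      \<comment> \<open>A real number lies strictly between b and D even if D is infinite.\<close>
      then obtain \<alpha> where "b < ereal \<alpha>" "ereal \<alpha> < D"
        using ereal_dense2[of b D] by (auto simp: not_le)
      then show False
        using b[of "ereal \<alpha>"] ach[of \<alpha>] by auto
    qed
  qed
  then show ?thesis
    using strategy by (simp add: D_def)
qed

end
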